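(* Let $w\in\{l,p,c\}$. Let $H:\mathbb{A}\to\mathcal{B}$ be an $\mathcal{F}$-functor from an $\mathcal{F}$-category to a 2-category, and suppose that $\mathbb{A}$ has $\bar{w}$-limits of loose morphisms and that $H$ is $w$-doctrinal. Then the decomposition $$\mathcal{A}_\tau\xrightarrow{\;j\;}\mathbb{A}\xrightarrow{\;H\;}\mathcal{B}$$ of the 2-functor $H_\tau:\mathcal{A}_\tau\to\mathcal{B}$ in the category of $\mathcal{F}$-categories and $\mathcal{F}$-functors is an orthogonal $({}^{\bot}w\text{-Doct},\,w\text{-Doct})$-decomposition; that is, $Hj=H_\tau$, $j$ is orthogonal to every $w$-doctrinal $\mathcal{F}$-functor, and $H$ is $w$-doctrinal.
   Context: **$\mathcal{F}$-categories.** An $\mathcal{F}$-category $\mathbb{A}$ is a pair of 2-categories $\mathcal{A}_\tau,\mathcal{A}_\lambda$ with a 2-functor $j:\mathcal{A}_\tau\to\mathcal{A}_\lambda$ that is the identity on objects, faithful (injective on 1-cells) and locally fully faithful. The 1-cells of $\mathcal{A}_\lambda$ are the loose morphisms (written $A\rightsquigarrow B$); those coming from $\mathcal{A}_\tau$ are the tight morphisms (written $A\to B$). An $\mathcal{F}$-functor $F:\mathbb{A}\to\mathbb{B}$ is a 2-functor $F_\lambda:\mathcal{A}_\lambda\to\mathcal{B}_\lambda$ taking tight morphisms to tight morphisms; $F_\tau:\mathcal{A}_\tau\to\mathcal{B}_\tau$ is its restriction. A 2-category is viewed as an $\mathcal{F}$-category in which all morphisms are tight. Thus there is an $\mathcal{F}$-functor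 $j:\mathcal{A}_\tau\to\mathbb{A}$, the identity on tight morphisms and given by $j:\mathcal{A}_\tau\to\mathcal{A}_\lambda$ on loose ones. $\mathbb{A}^{co}$ is obtained by reversing 2-cells. An adjunction $(\epsilon,f\dashv g,\eta)$ in $\mathbb{A}$ means an adjunction in $\mathcal{A}_\lambda$ (counit $\epsilon$, unit $\eta$). **Reflections.** An $l$-reflection $(1,f\dashv g,\eta)$ is an adjunction with tight left adjoint $f$ and identity counit; it is a $p$-reflection if moreover $\eta$ is invertible. For $w\in\{l,p\}$, given $w$-reflections $(1,f_i\dashv g_i,\eta_i)$, $i=1,2$, a tight commuting square $(r,s):f_1\to f_2$ (i.e. $r,s$ tight with $f_2r=sf_1$) is a morphism of $w$-reflections if $g_2s=rg_1$ and $r\eta_1=\eta_2r$. **$w$-doctrinal.** For $w\in\{l,p\}$ an $\mathcal{F}$-functor $H:\mathbb{A}\to\mathbb{B}$ satisfies - $w$-Refl if for each tight $f$ in $\mathbb{A}$, each $w$-reflection $(1,Hf\dashv g,\eta)$ in $\mathbb{B}$ lifts uniquely along $H$ to a $w$-reflection $(1,f\dashv g',\eta')$ in $\mathbb{A}$ (so $Hg'=g$, $H\eta'=\eta$); - $w$-Morph if, given $w$-reflections $(1,f_i\dashv g_i,\eta_i)$ in $\mathbb{A}$, $i=1,2$, a tight commuting square $(r,s):f_1\to f_2$ is a morphism of $w$-reflections just when $(Hr,Hs):Hf_1\to Hf_2$ is one. $H$ satisfies $c$-Refl or $c$-Morph if $H^{co}:\mathbb{A}^{co}\to\mathbb{B}^{co}$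 satisfies $l$-Refl or $l$-Morph. For $w\in\{l,p,c\}$, $H$ is $w$-doctrinal if it satisfies $w$-Refl, $w$-Morph and is locally faithful, i.e. $H_\lambda$ reflects equality of parallel 2-cells. $w\text{-Doct}$ is the class of $w$-doctrinal $\mathcal{F}$-functors, and ${}^{\bot}w\text{-Doct}$ the class of $\mathcal{F}$-functors $J:\mathbb{X}\to\mathbb{Y}$ orthogonal to each of them: for each $w$-doctrinal $G:\mathbb{B}\to\mathbb{C}$ and each commuting square $GR=SJ$ there is a unique $K:\mathbb{Y}\to\mathbb{B}$ with $KJ=R$ and $GK=S$. **Limits of loose morphisms.** Put $\bar{l}=c$, $\bar{p}=p$, $\bar{c}=l$. The colax limit ($c$-limit) of a loose $f:A\rightsquigarrow B$ consists of an object $C_f$, tight morphisms $p_f:C_f\to A$, $q_f:C_f\to B$ and a 2-cell $\lambda_f:q_f\Rightarrow fp_f$ such that: (1) for every colax cone $(r:X\rightsquigarrow A,\ \alpha:s\Rightarrow fr,\ s:X\rightsquigarrow B)$ there is a unique $t:X\rightsquigarrow C_f$ with $p_ft=r$, $q_ft=s$, $\lambda_ft=\alpha$; (2) given colax cones $(r,\alpha,s)$, $(r',\alpha',s')$ from $X$, with induced $t,t'$, and 2-cells $\theta_r:r\Rightarrow r'$, $\theta_s:s\Rightarrow s'$ with $\alpha'\circ\theta_s=(f\theta_r)\circ\alpha$, there is a unique 2-cell $\phi:t\Rightarrow t'$ with $p_f\phi=\theta_r$, $q_f\phi=\theta_s$; (3) $t:X\rightsquigarrow C_f$ is tight just when $p_ft$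 and $q_ft$ are tight. The pseudolimit ($p$-limit) is defined in the same way with $\lambda_f$ and the 2-cells $\alpha$ of all cones required invertible. The lax limit ($l$-limit) of $f$ in $\mathbb{A}$ is the colax limit of $f$ in $\mathbb{A}^{co}$. *)

theory Defs
  imports Main
begin

text \<open>2-categories are strict. All composites \<open>g \<odot> f\<close>, \<open>\<beta> \<bullet> \<alpha>\<close> (vertical) and
  \<open>\<beta> \<star> \<alpha>\<close> (horizontal) are in application order. All operations are total
  functions whose values are only meaningful on composable arguments in the carriers.\<close>

record ('o, 'm, 'c) two_cat =
  Obj :: "'o set"
  Mor :: "'m set"
  src :: "'m \<Rightarrow> 'o"
  trg :: "'m \<Rightarrow> 'o"
  id1 :: "'o \<Rightarrow> 'm"
  comp1 :: "'m \<Rightarrow> 'm \<Rightarrow> 'm"  (infixr "\<odot>\<index>" 75)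
  Cell :: "'c set"
  dom2 :: "'c \<Rightarrow> 'm"
  cod2 :: "'c \<Rightarrow> 'm"
  id2 :: "'m \<Rightarrow> 'c"
  vcomp :: "'c \<Rightarrow> 'c \<Rightarrow> 'c"  (infixr "\<bullet>\<index>" 70)
  hcomp :: "'c \<Rightarrow> 'c \<Rightarrow> 'c"  (infixr "\<star>\<index>" 75)

definition hom1 :: "('o, 'm, 'c) two_cat \<Rightarrow> 'o \<Rightarrow> 'o \<Rightarrow> 'm set" where
  "hom1 A X Y = {f \<in> Mor A. src A f = X \<and> trg A f = Y}"

definition hom2 :: "('o, 'm, 'c) two_cat \<Rightarrow> 'm \<Rightarrow> 'm \<Rightarrow> 'c set" where
  "hom2 A f g = {\<alpha> \<in> Cell A. dom2 A \<alpha> = f \<and> cod2 A \<alpha> = g}"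

locale two_category =
  fixes A :: "('o, 'm, 'c) two_cat" (structure)
  assumes src_trg: "f \<in> Mor A \<Longrightarrow> src A f \<in> Obj A \<and> trg A f \<in> Obj A"
    and id1_hom: "X \<in> Obj A \<Longrightarrow> id1 A X \<in> hom1 A X X"
    and comp1_hom: "\<lbrakk>f \<in> hom1 A X Y; g \<in> hom1 A Y Z\<rbrakk> \<Longrightarrow> g \<odot> f \<in> hom1 A X Z"
    and comp1_id_left: "f \<in> hom1 A X Y \<Longrightarrow> id1 A Y \<odot> f = f"
    and comp1_id_right: "f \<in> hom1 A X Y \<Longrightarrow> f \<odot> id1 A X = f"
    and comp1_assoc: "\<lbrakk>f \<in> hom1 A W X; g \<in> hom1 A X Y; h \<in> hom1 A Y Z\<rbrakk>
          \<Longrightarrow> (h \<odot> g) \<odot> f = h \<odot> (g \<odot> f)"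
    and dom_cod: "\<alpha> \<in> Cell A \<Longrightarrow> dom2 A \<alpha> \<in> Mor A \<and> cod2 A \<alpha> \<in> Mor A
          \<and> src A (dom2 A \<alpha>) = src A (cod2 A \<alpha>) \<and> trg A (dom2 A \<alpha>) = trg A (cod2 A \<alpha>)"
    and id2_hom: "f \<in> Mor A \<Longrightarrow> id2 A f \<in> hom2 A f f"
    and vcomp_hom: "\<lbrakk>\<alpha> \<in> hom2 A f g; \<beta> \<in> hom2 A g h\<rbrakk> \<Longrightarrow> \<beta> \<bullet> \<alpha> \<in> hom2 A f h"
    and vcomp_id_left: "\<alpha> \<in> hom2 A f g \<Longrightarrow> id2 A g \<bullet> \<alpha> = \<alpha>"
    and vcomp_id_right: "\<alpha> \<in> hom2 A f g \<Longrightarrow> \<alpha> \<bullet> id2 A f = \<alpha>"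
    and vcomp_assoc: "\<lbrakk>\<alpha> \<in> hom2 A f g; \<beta> \<in> hom2 A g h; \<gamma> \<in> hom2 A h k\<rbrakk>
          \<Longrightarrow> (\<gamma> \<bullet> \<beta>) \<bullet> \<alpha> = \<gamma> \<bullet> (\<beta> \<bullet> \<alpha>)"
    and hcomp_hom: "\<lbrakk>\<alpha> \<in> hom2 A f f'; \<beta> \<in> hom2 A g g'; trg A f = src A g\<rbrakk>
          \<Longrightarrow> \<beta> \<star> \<alpha> \<in> hom2 A (g \<odot> f) (g' \<odot> f')"
    and hcomp_id2: "\<lbrakk>f \<in> hom1 A X Y; g \<in> hom1 A Y Z\<rbrakk> \<Longrightarrow> id2 A g \<star> id2 A f = id2 A (g \<odot> f)"
    and interchange: "\<lbrakk>\<alpha> \<in> hom2 A f f'; \<alpha>' \<in> hom2 A f' f''; \<beta> \<in> hom2 A g g';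
          \<beta>' \<in> hom2 A g' g''; trg A f = src A g\<rbrakk>
          \<Longrightarrow> (\<beta>' \<bullet> \<beta>) \<star> (\<alpha>' \<bullet> \<alpha>) = (\<beta>' \<star> \<alpha>') \<bullet> (\<beta> \<star> \<alpha>)"
    and hcomp_id_left: "\<lbrakk>\<alpha> \<in> hom2 A f g; f \<in> hom1 A X Y\<rbrakk> \<Longrightarrow> id2 A (id1 A Y) \<star> \<alpha> = \<alpha>"
    and hcomp_id_right: "\<lbrakk>\<alpha> \<in> hom2 A f g; f \<in> hom1 A X Y\<rbrakk> \<Longrightarrow> \<alpha> \<star> id2 A (id1 A X) = \<alpha>"
    and hcomp_assoc: "\<lbrakk>\<alpha> \<in> hom2 A f f'; \<beta> \<in> hom2 A g g'; \<gamma> \<in> hom2 A h h';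
          trg A f = src A g; trg A g = src A h\<rbrakk>
          \<Longrightarrow> (\<gamma> \<star> \<beta>) \<star> \<alpha> = \<gamma> \<star> (\<beta> \<star> \<alpha>)"

text \<open>Whiskering \<open>f \<theta>\<close> and \<open>\<theta> f\<close> of a 2-cell by a 1-cell.\<close>

abbreviation lwhisk :: "('o, 'm, 'c) two_cat \<Rightarrow> 'm \<Rightarrow> 'c \<Rightarrow> 'c" where
  "lwhisk A f \<theta> \<equiv> id2 A f \<star>\<^bsub>A\<^esub> \<theta>"

abbreviation rwhisk :: "('o, 'm, 'c) two_cat \<Rightarrow> 'c \<Rightarrow> 'm \<Rightarrow> 'c" where
  "rwhisk A \<theta> f \<equiv> \<theta> \<star>\<^bsub>A\<^esub> id2 A f"

definition invertible2 :: "('o, 'm, 'c) two_cat \<Rightarrow> 'c \<Rightarrow> bool" where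
  "invertible2 A \<alpha> \<longleftrightarrow> \<alpha> \<in> Cell A \<and>
     (\<exists>\<beta> \<in> hom2 A (cod2 A \<alpha>) (dom2 A \<alpha>).
        \<beta> \<bullet>\<^bsub>A\<^esub> \<alpha> = id2 A (dom2 A \<alpha>) \<and> \<alpha> \<bullet>\<^bsub>A\<^esub> \<beta> = id2 A (cod2 A \<alpha>))"

record ('o, 'm, 'c, 'p, 'n, 'd) two_fun =
  on0 :: "'o \<Rightarrow> 'p"
  on1 :: "'m \<Rightarrow> 'n"
  on2 :: "'c \<Rightarrow> 'd"

locale two_functor = A: two_category A + B: two_category B
  for A :: "('o, 'm, 'c) two_cat" and B :: "('p, 'n, 'd) two_cat" +
  fixes F :: "('o, 'm, 'c, 'p, 'n, 'd) two_fun"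
  assumes on0_Obj: "X \<in> Obj A \<Longrightarrow> on0 F X \<in> Obj B"
    and on1_hom: "f \<in> hom1 A X Y \<Longrightarrow> on1 F f \<in> hom1 B (on0 F X) (on0 F Y)"
    and on1_id1: "X \<in> Obj A \<Longrightarrow> on1 F (id1 A X) = id1 B (on0 F X)"
    and on1_comp1: "\<lbrakk>f \<in> hom1 A X Y; g \<in> hom1 A Y Z\<rbrakk>
          \<Longrightarrow> on1 F (g \<odot>\<^bsub>A\<^esub> f) = on1 F g \<odot>\<^bsub>B\<^esub> on1 F f"
    and on2_hom: "\<alpha> \<in> hom2 A f g \<Longrightarrow> on2 F \<alpha> \<in> hom2 B (on1 F f) (on1 F g)"
    and on2_id2: "f \<in> Mor A \<Longrightarrow> on2 F (id2 A f) = id2 B (on1 F f)"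
    and on2_vcomp: "\<lbrakk>\<alpha> \<in> hom2 A f g; \<beta> \<in> hom2 A g h\<rbrakk>
          \<Longrightarrow> on2 F (\<beta> \<bullet>\<^bsub>A\<^esub> \<alpha>) = on2 F \<beta> \<bullet>\<^bsub>B\<^esub> on2 F \<alpha>"
    and on2_hcomp: "\<lbrakk>\<alpha> \<in> hom2 A f f'; \<beta> \<in> hom2 A g g'; trg A f = src A g\<rbrakk>
          \<Longrightarrow> on2 F (\<beta> \<star>\<^bsub>A\<^esub> \<alpha>) = on2 F \<beta> \<star>\<^bsub>B\<^esub> on2 F \<alpha>"

definition id_fun :: "('o, 'm, 'c, 'o, 'm, 'c) two_fun" where
  "id_fun = \<lparr>on0 = (\<lambda>X. X), on1 = (\<lambda>f. f), on2 = (\<lambda>\<alpha>. \<alpha>)\<rparr>"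

definition comp_fun ::
    "('p, 'n, 'd, 'q, 'k, 'e) two_fun \<Rightarrow> ('o, 'm, 'c, 'p, 'n, 'd) two_fun
      \<Rightarrow> ('o, 'm, 'c, 'q, 'k, 'e) two_fun"  (infixr "\<circ>\<^sub>2" 75) where
  "G \<circ>\<^sub>2 F = \<lparr>on0 = on0 G \<circ> on0 F, on1 = on1 G \<circ> on1 F, on2 = on2 G \<circ> on2 F\<rparr>"

text \<open>Equality of 2-functors out of \<open>A\<close>; values outside the carriers are junk.\<close>

definition fun_eq ::
    "('o, 'm, 'c) two_cat \<Rightarrow> ('o, 'm, 'c, 'p, 'n, 'd) two_fun
      \<Rightarrow> ('o, 'm, 'c, 'p, 'n, 'd) two_fun \<Rightarrow> bool" where
  "fun_eq A F G \<longleftrightarrow> (\<forall>X \<in> Obj A. on0 F X = on0 G X) \<and> (\<forall>f \<in> Mor A. on1 F f = on1 G f) \<and>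
     (\<forall>\<alpha> \<in> Cell A. on2 F \<alpha> = on2 G \<alpha>)"

definition co2 :: "('o, 'm, 'c) two_cat \<Rightarrow> ('o, 'm, 'c) two_cat" where
  "co2 A = A\<lparr>dom2 := cod2 A, cod2 := dom2 A, vcomp := (\<lambda>\<beta> \<alpha>. \<alpha> \<bullet>\<^bsub>A\<^esub> \<beta>)\<rparr>"

record ('o, 'm, 'c, 'n, 'd) F_cat =
  tight :: "('o, 'm, 'c) two_cat"
  loose :: "('o, 'n, 'd) two_cat"
  incl :: "('o, 'm, 'c, 'o, 'n, 'd) two_fun"

definition F_category :: "('o, 'm, 'c, 'n, 'd) F_cat \<Rightarrow> bool" where
  "F_category A \<longleftrightarrow> two_functor (tight A) (loose A) (incl A) \<and>
     Obj (tight A) = Obj (loose A) \<and> (\<forall>X \<in> Obj (tight A). on0 (incl A) X = X) \<and>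
     inj_on (on1 (incl A)) (Mor (tight A)) \<and>
     (\<forall>X Y. \<forall>f \<in> hom1 (tight A) X Y. \<forall>g \<in> hom1 (tight A) X Y.
        bij_betw (on2 (incl A)) (hom2 (tight A) f g)
          (hom2 (loose A) (on1 (incl A) f) (on1 (incl A) g)))"

definition is_tight :: "('o, 'm, 'c, 'n, 'd) F_cat \<Rightarrow> 'n \<Rightarrow> bool" where
  "is_tight A f \<longleftrightarrow> f \<in> on1 (incl A) ` Mor (tight A)"

text \<open>An F-functor is given by its action on the loose 2-categories.\<close>

definition F_functor ::
    "('o, 'm, 'c, 'n, 'd) F_cat \<Rightarrow> ('o1, 'm1, 'c1, 'n1, 'd1) F_cat
      \<Rightarrow> ('o, 'n, 'd, 'o1, 'n1, 'd1) two_fun \<Rightarrow> bool" where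
  "F_functor A B F \<longleftrightarrow> F_category A \<and> F_category B \<and> two_functor (loose A) (loose B) F \<and>
     (\<forall>f. is_tight A f \<longrightarrow> is_tight B (on1 F f))"

text \<open>The restriction \<open>F\<^sub>\<tau>\<close> of an F-functor, i.e. the 2-functor with
  \<open>incl B \<circ>\<^sub>2 F\<^sub>\<tau> = F \<circ>\<^sub>2 incl A\<close>. The inclusion of an F-category is injective
  on 1-cells, hence, being locally faithful, on 2-cells.\<close>

definition tight_part ::
    "('o, 'm, 'c, 'n, 'd) F_cat \<Rightarrow> ('o1, 'm1, 'c1, 'n1, 'd1) F_cat
      \<Rightarrow> ('o, 'n, 'd, 'o1, 'n1, 'd1) two_fun \<Rightarrow> ('o, 'm, 'c, 'o1, 'm1, 'c1) two_fun" where
  "tight_part A B F =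
     \<lparr>on0 = on0 F,
      on1 = (\<lambda>f. inv_into (Mor (tight B)) (on1 (incl B)) (on1 F (on1 (incl A) f))),
      on2 = (\<lambda>\<alpha>. inv_into (Cell (tight B)) (on2 (incl B)) (on2 F (on2 (incl A) \<alpha>)))\<rparr>"

text \<open>A 2-category as an F-category with all morphisms tight. With this convention the 2-functor
  \<open>incl A\<close> is itself the F-functor from \<open>all_tight (tight A)\<close> to \<open>A\<close>.\<close>

definition all_tight :: "('o, 'm, 'c) two_cat \<Rightarrow> ('o, 'm, 'c, 'm, 'c) F_cat" where
  "all_tight A = \<lparr>tight = A, loose = A, incl = id_fun\<rparr>"

text \<open>On F-functors, \<open>H\<^sup>c\<^sup>o\<close> has the same underlying maps as \<open>H\<close>.\<close>

definition co :: "('o, 'm, 'c, 'n, 'd) F_cat \<Rightarrow> ('o, 'm, 'c, 'n, 'd) F_cat" where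
  "co A = \<lparr>tight = co2 (tight A), loose = co2 (loose A), incl = incl A\<rparr>"

definition adjunction :: "('o, 'm, 'c) two_cat \<Rightarrow> 'c \<Rightarrow> 'm \<Rightarrow> 'm \<Rightarrow> 'c \<Rightarrow> bool" where
  "adjunction A \<epsilon> f g \<eta> \<longleftrightarrow>
     (\<exists>X Y. f \<in> hom1 A X Y \<and> g \<in> hom1 A Y X \<and>
        \<eta> \<in> hom2 A (id1 A X) (g \<odot>\<^bsub>A\<^esub> f) \<and> \<epsilon> \<in> hom2 A (f \<odot>\<^bsub>A\<^esub> g) (id1 A Y) \<and>
        rwhisk A \<epsilon> f \<bullet>\<^bsub>A\<^esub> lwhisk A f \<eta> = id2 A f \<and>
        lwhisk A g \<epsilon> \<bullet>\<^bsub>A\<^esub> rwhisk A \<eta> g = id2 A g)"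

definition l_reflection ::
    "('o, 'm, 'c, 'n, 'd) F_cat \<Rightarrow> 'n \<Rightarrow> 'n \<Rightarrow> 'd \<Rightarrow> bool" where
  "l_reflection A f g \<eta> \<longleftrightarrow>
     is_tight A f \<and> adjunction (loose A) (id2 (loose A) (id1 (loose A) (trg (loose A) f))) f g \<eta>"

definition p_reflection ::
    "('o, 'm, 'c, 'n, 'd) F_cat \<Rightarrow> 'n \<Rightarrow> 'n \<Rightarrow> 'd \<Rightarrow> bool" where
  "p_reflection A f g \<eta> \<longleftrightarrow> l_reflection A f g \<eta> \<and> invertible2 (loose A) \<eta>"

definition tight_square ::
    "('o, 'm, 'c, 'n, 'd) F_cat \<Rightarrow> 'n \<Rightarrow> 'n \<Rightarrow> 'n \<Rightarrow> 'n \<Rightarrow> bool" where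
  "tight_square A f1 f2 r s \<longleftrightarrow>
     is_tight A f1 \<and> is_tight A f2 \<and> is_tight A r \<and> is_tight A s \<and>
     r \<in> hom1 (loose A) (src (loose A) f1) (src (loose A) f2) \<and>
     s \<in> hom1 (loose A) (trg (loose A) f1) (trg (loose A) f2) \<and>
     f2 \<odot>\<^bsub>loose A\<^esub> r = s \<odot>\<^bsub>loose A\<^esub> f1"

text \<open>When a tight square \<open>(r, s)\<close> between the left adjoints of reflections
  \<open>(1, f1 \<stileturn> g1, \<eta>1)\<close> and \<open>(1, f2 \<stileturn> g2, \<eta>2)\<close> is a morphism of reflections; the condition is
  the same for l- and p-reflections.\<close>

definition refl_morphism ::
    "('o, 'm, 'c, 'n, 'd) F_cat \<Rightarrow> 'n \<Rightarrow> 'n \<Rightarrow> 'd \<Rightarrow> 'n \<Rightarrow> 'n \<Rightarrow> 'd \<Rightarrow> 'n \<Rightarrow> 'n \<Rightarrow> bool" where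
  "refl_morphism A f1 g1 \<eta>1 f2 g2 \<eta>2 r s \<longleftrightarrow> tight_square A f1 f2 r s \<and>
     g2 \<odot>\<^bsub>loose A\<^esub> s = r \<odot>\<^bsub>loose A\<^esub> g1 \<and>
     lwhisk (loose A) r \<eta>1 = rwhisk (loose A) \<eta>2 r"

definition l_Refl ::
    "('o, 'm, 'c, 'n, 'd) F_cat \<Rightarrow> ('o1, 'm1, 'c1, 'n1, 'd1) F_cat
      \<Rightarrow> ('o, 'n, 'd, 'o1, 'n1, 'd1) two_fun \<Rightarrow> bool" where
  "l_Refl A B H \<longleftrightarrow> (\<forall>f g \<eta>. is_tight A f \<and> l_reflection B (on1 H f) g \<eta> \<longrightarrow>
     (\<exists>!(g', \<eta>'). l_reflection A f g' \<eta>' \<and> on1 H g' = g \<and> on2 H \<eta>' = \<eta>))"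

definition p_Refl ::
    "('o, 'm, 'c, 'n, 'd) F_cat \<Rightarrow> ('o1, 'm1, 'c1, 'n1, 'd1) F_cat
      \<Rightarrow> ('o, 'n, 'd, 'o1, 'n1, 'd1) two_fun \<Rightarrow> bool" where
  "p_Refl A B H \<longleftrightarrow> (\<forall>f g \<eta>. is_tight A f \<and> p_reflection B (on1 H f) g \<eta> \<longrightarrow>
     (\<exists>!(g', \<eta>'). p_reflection A f g' \<eta>' \<and> on1 H g' = g \<and> on2 H \<eta>' = \<eta>))"

definition l_Morph ::
    "('o, 'm, 'c, 'n, 'd) F_cat \<Rightarrow> ('o1, 'm1, 'c1, 'n1, 'd1) F_cat
      \<Rightarrow> ('o, 'n, 'd, 'o1, 'n1, 'd1) two_fun \<Rightarrow> bool" where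
  "l_Morph A B H \<longleftrightarrow> (\<forall>f1 g1 \<eta>1 f2 g2 \<eta>2 r s.
     l_reflection A f1 g1 \<eta>1 \<and> l_reflection A f2 g2 \<eta>2 \<and> tight_square A f1 f2 r s \<longrightarrow>
     (refl_morphism A f1 g1 \<eta>1 f2 g2 \<eta>2 r s \<longleftrightarrow>
      refl_morphism B (on1 H f1) (on1 H g1) (on2 H \<eta>1) (on1 H f2) (on1 H g2) (on2 H \<eta>2)
        (on1 H r) (on1 H s)))"

definition p_Morph ::
    "('o, 'm, 'c, 'n, 'd) F_cat \<Rightarrow> ('o1, 'm1, 'c1, 'n1, 'd1) F_cat
      \<Rightarrow> ('o, 'n, 'd, 'o1, 'n1, 'd1) two_fun \<Rightarrow> bool" where
  "p_Morph A B H \<longleftrightarrow> (\<forall>f1 g1 \<eta>1 f2 g2 \<eta>2 r s.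
     p_reflection A f1 g1 \<eta>1 \<and> p_reflection A f2 g2 \<eta>2 \<and> tight_square A f1 f2 r s \<longrightarrow>
     (refl_morphism A f1 g1 \<eta>1 f2 g2 \<eta>2 r s \<longleftrightarrow>
      refl_morphism B (on1 H f1) (on1 H g1) (on2 H \<eta>1) (on1 H f2) (on1 H g2) (on2 H \<eta>2)
        (on1 H r) (on1 H s)))"

definition locally_faithful ::
    "('o, 'm, 'c) two_cat \<Rightarrow> ('o, 'm, 'c, 'p, 'n, 'd) two_fun \<Rightarrow> bool" where
  "locally_faithful A F \<longleftrightarrow>
     (\<forall>f g. \<forall>\<alpha> \<in> hom2 A f g. \<forall>\<beta> \<in> hom2 A f g. on2 F \<alpha> = on2 F \<beta> \<longrightarrow> \<alpha> = \<beta>)"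

text \<open>\<open>w \<in> {l, p, c}\<close>; in this order.\<close>

datatype laxity = Lax | Pseudo | Colax

fun w_Refl ::
    "laxity \<Rightarrow> ('o, 'm, 'c, 'n, 'd) F_cat \<Rightarrow> ('o1, 'm1, 'c1, 'n1, 'd1) F_cat
      \<Rightarrow> ('o, 'n, 'd, 'o1, 'n1, 'd1) two_fun \<Rightarrow> bool" where
  "w_Refl Lax A B H = l_Refl A B H"
| "w_Refl Pseudo A B H = p_Refl A B H"
| "w_Refl Colax A B H = l_Refl (co A) (co B) H"

fun w_Morph ::
    "laxity \<Rightarrow> ('o, 'm, 'c, 'n, 'd) F_cat \<Rightarrow> ('o1, 'm1, 'c1, 'n1, 'd1) F_cat
      \<Rightarrow> ('o, 'n, 'd, 'o1, 'n1, 'd1) two_fun \<Rightarrow> bool" where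
  "w_Morph Lax A B H = l_Morph A B H"
| "w_Morph Pseudo A B H = p_Morph A B H"
| "w_Morph Colax A B H = l_Morph (co A) (co B) H"

definition doctrinal ::
    "laxity \<Rightarrow> ('o, 'm, 'c, 'n, 'd) F_cat \<Rightarrow> ('o1, 'm1, 'c1, 'n1, 'd1) F_cat
      \<Rightarrow> ('o, 'n, 'd, 'o1, 'n1, 'd1) two_fun \<Rightarrow> bool" where
  "doctrinal w A B H \<longleftrightarrow> F_functor A B H \<and>
     w_Refl w A B H \<and> w_Morph w A B H \<and> locally_faithful (loose A) H"

text \<open>\<open>orthogonal X Y J B C G\<close>: the F-functor \<open>J\<close> from \<open>X\<close> to \<open>Y\<close> is (left) orthogonal to the
  F-functor \<open>G\<close> from \<open>B\<close> to \<open>C\<close>.\<close>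

definition orthogonal ::
    "('o, 'm, 'c, 'n, 'd) F_cat \<Rightarrow> ('o1, 'm1, 'c1, 'n1, 'd1) F_cat
      \<Rightarrow> ('o, 'n, 'd, 'o1, 'n1, 'd1) two_fun
      \<Rightarrow> ('o2, 'm2, 'c2, 'n2, 'd2) F_cat \<Rightarrow> ('o3, 'm3, 'c3, 'n3, 'd3) F_cat
      \<Rightarrow> ('o2, 'n2, 'd2, 'o3, 'n3, 'd3) two_fun \<Rightarrow> bool" where
  "orthogonal X Y J B C G \<longleftrightarrow>
     (\<forall>R S. F_functor X B R \<and> F_functor Y C S \<and> fun_eq (loose X) (G \<circ>\<^sub>2 R) (S \<circ>\<^sub>2 J) \<longrightarrow>
        (\<exists>K. F_functor Y B K \<and>
           fun_eq (loose X) (K \<circ>\<^sub>2 J) R \<and> fun_eq (loose Y) (G \<circ>\<^sub>2 K) S \<and>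
           (\<forall>K'. F_functor Y B K' \<and>
              fun_eq (loose X) (K' \<circ>\<^sub>2 J) R \<and> fun_eq (loose Y) (G \<circ>\<^sub>2 K') S \<longrightarrow>
              fun_eq (loose Y) K' K)))"

definition colax_cone ::
    "('o, 'm, 'c, 'n, 'd) F_cat \<Rightarrow> 'n \<Rightarrow> 'o \<Rightarrow> 'n \<Rightarrow> 'd \<Rightarrow> 'n \<Rightarrow> bool" where
  "colax_cone A f X r \<alpha> s \<longleftrightarrow>
     r \<in> hom1 (loose A) X (src (loose A) f) \<and> s \<in> hom1 (loose A) X (trg (loose A) f) \<and>
     \<alpha> \<in> hom2 (loose A) s (f \<odot>\<^bsub>loose A\<^esub> r)"

definition pseudo_cone ::
    "('o, 'm, 'c, 'n, 'd) F_cat \<Rightarrow> 'n \<Rightarrow> 'o \<Rightarrow> 'n \<Rightarrow> 'd \<Rightarrow> 'n \<Rightarrow> bool" where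
  "pseudo_cone A f X r \<alpha> s \<longleftrightarrow> colax_cone A f X r \<alpha> s \<and> invertible2 (loose A) \<alpha>"

text \<open>\<open>t\<close> is a factorisation of the cone \<open>(r, \<alpha>, s)\<close> with vertex \<open>X\<close> through the cone
  \<open>(p, l, q)\<close> with vertex \<open>C\<close>.\<close>

definition factors_cone ::
    "('o, 'm, 'c) two_cat \<Rightarrow> 'o \<Rightarrow> 'm \<Rightarrow> 'c \<Rightarrow> 'm \<Rightarrow> 'o \<Rightarrow> 'm \<Rightarrow> 'c \<Rightarrow> 'm \<Rightarrow> 'm \<Rightarrow> bool" where
  "factors_cone A C p l q X r \<alpha> s t \<longleftrightarrow>
     t \<in> hom1 A X C \<and> p \<odot>\<^bsub>A\<^esub> t = r \<and> q \<odot>\<^bsub>A\<^esub> t = s \<and> rwhisk A l t = \<alpha>"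

text \<open>\<open>(p, l, q)\<close> with vertex \<open>C\<close> is the limit of the loose \<open>f\<close> with respect to the given
  class \<open>cone\<close> of cones over \<open>f\<close>.\<close>

definition cone_limit ::
    "('o, 'm, 'c, 'n, 'd) F_cat \<Rightarrow> ('o \<Rightarrow> 'n \<Rightarrow> 'd \<Rightarrow> 'n \<Rightarrow> bool)
      \<Rightarrow> 'n \<Rightarrow> 'o \<Rightarrow> 'n \<Rightarrow> 'd \<Rightarrow> 'n \<Rightarrow> bool" where
  "cone_limit A cone f C p l q \<longleftrightarrow>
     is_tight A p \<and> is_tight A q \<and> cone C p l q \<and>
     (\<forall>X r \<alpha> s. cone X r \<alpha> s \<longrightarrow> (\<exists>!t. factors_cone (loose A) C p l q X r \<alpha> s t)) \<and>
     (\<forall>X r \<alpha> s r' \<alpha>' s' t t'. \<forall>\<theta>\<^sub>r \<in> hom2 (loose A) r r'. \<forall>\<theta>\<^sub>s \<in> hom2 (loose A) s s'.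
        cone X r \<alpha> s \<and> cone X r' \<alpha>' s' \<and>
        factors_cone (loose A) C p l q X r \<alpha> s t \<and>
        factors_cone (loose A) C p l q X r' \<alpha>' s' t' \<and>
        \<alpha>' \<bullet>\<^bsub>loose A\<^esub> \<theta>\<^sub>s = lwhisk (loose A) f \<theta>\<^sub>r \<bullet>\<^bsub>loose A\<^esub> \<alpha> \<longrightarrow>
        (\<exists>!\<phi>. \<phi> \<in> hom2 (loose A) t t' \<and>
           lwhisk (loose A) p \<phi> = \<theta>\<^sub>r \<and> lwhisk (loose A) q \<phi> = \<theta>\<^sub>s)) \<and>
     (\<forall>X. \<forall>t \<in> hom1 (loose A) X C.
        is_tight A t \<longleftrightarrow> is_tight A (p \<odot>\<^bsub>loose A\<^esub> t) \<and> is_tight A (q \<odot>\<^bsub>loose A\<^esub> t))"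

definition colax_limit ::
    "('o, 'm, 'c, 'n, 'd) F_cat \<Rightarrow> 'n \<Rightarrow> 'o \<Rightarrow> 'n \<Rightarrow> 'd \<Rightarrow> 'n \<Rightarrow> bool" where
  "colax_limit A f C p l q \<longleftrightarrow> cone_limit A (colax_cone A f) f C p l q"

definition pseudo_limit ::
    "('o, 'm, 'c, 'n, 'd) F_cat \<Rightarrow> 'n \<Rightarrow> 'o \<Rightarrow> 'n \<Rightarrow> 'd \<Rightarrow> 'n \<Rightarrow> bool" where
  "pseudo_limit A f C p l q \<longleftrightarrow> cone_limit A (pseudo_cone A f) f C p l q"

definition lax_limit ::
    "('o, 'm, 'c, 'n, 'd) F_cat \<Rightarrow> 'n \<Rightarrow> 'o \<Rightarrow> 'n \<Rightarrow> 'd \<Rightarrow> 'n \<Rightarrow> bool" where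
  "lax_limit A f C p l q \<longleftrightarrow> colax_limit (co A) f C p l q"

fun w_limit ::
    "laxity \<Rightarrow> ('o, 'm, 'c, 'n, 'd) F_cat \<Rightarrow> 'n \<Rightarrow> 'o \<Rightarrow> 'n \<Rightarrow> 'd \<Rightarrow> 'n \<Rightarrow> bool" where
  "w_limit Lax A f C p l q = lax_limit A f C p l q"
| "w_limit Pseudo A f C p l q = pseudo_limit A f C p l q"
| "w_limit Colax A f C p l q = colax_limit A f C p l q"

definition has_loose_limits :: "laxity \<Rightarrow> ('o, 'm, 'c, 'n, 'd) F_cat \<Rightarrow> bool" where
  "has_loose_limits w A \<longleftrightarrow> (\<forall>f \<in> Mor (loose A). \<exists>C p l q. w_limit w A f C p l q)"

fun bar :: "laxity \<Rightarrow> laxity" where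
  "bar Lax = Colax"
| "bar Pseudo = Pseudo"
| "bar Colax = Lax"

end

theory Submission
  imports Defs
begin

text \<open>The point is that limits of loose morphisms let every loose morphism \<open>f : A \<rightarrow> B\<close> be
  rebuilt from tight ones and reflections, and that reflections lift uniquely along doctrinal
  F-functors. Take \<open>w = l\<close>. The colax limit of \<open>f\<close>, with projections \<open>p\<close>, \<open>q\<close> and 2-cell
  \<open>\<lambda> : q \<Rightarrow> f p\<close>, receives a section \<open>d\<close> of \<open>p\<close> induced by the cone \<open>(1, id, f)\<close>, so that
  \<open>q d = f\<close>; and \<open>\<lambda>\<close> induces a unit \<open>\<eta> : 1 \<Rightarrow> d p\<close> with \<open>p \<eta> = id\<close> and \<open>q \<eta> = \<lambda>\<close>, which makes
  \<open>p \<stileturn> d\<close> an l-reflection (\<open>limit_reflection\<close>). Thus \<open>f\<close> is a tight morphism after the right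
  adjoint of a tight one.

  Let now \<open>G R = S j\<close> with \<open>G\<close> doctrinal. A filler \<open>K\<close> preserves reflections, so \<open>K d\<close> must be the
  right adjoint \<open>d'\<close> in the unique lift of the reflection \<open>(1, S p \<stileturn> S d, S \<eta>)\<close> to one with left
  adjoint \<open>R p\<close>. Hence \<open>K f = R q d'\<close> is forced, and local faithfulness of \<open>G\<close> settles the 2-cells.

  Existence rests on \<open>K1_presentation\<close>: if \<open>u \<stileturn> v\<close> is any reflection and \<open>k\<close>, \<open>t\<close> are tight with
  \<open>k v = f t\<close>, then \<open>(K f) (R t) = (R k) v'\<close>, where \<open>v'\<close> is the lift of \<open>S v\<close>. The universal property
  of the limit gives a tight comparison \<open>c\<close> into it which is a morphism of reflections
  (\<open>comparison\<close>), and w-Morph transports this along \<open>R\<close>. Trivial reflections show that \<open>K\<close> extends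
  \<open>R\<close>; composite reflections show that \<open>K\<close> preserves composition (\<open>K1_comp\<close>). A 2-cell
  \<open>\<alpha> : f \<Rightarrow> g\<close> is likewise expressed by tight data and reflections (\<open>lax_cell_presentation\<close> and
  \<open>pseudo_cell_presentation\<close>), which yields a 2-cell \<open>K f \<Rightarrow> K g\<close> over \<open>S \<alpha>\<close>. Since \<open>G\<close> is locally
  faithful, this 2-cell is unique and all equations between 2-cells can be checked after applying \<open>G\<close>.

  For \<open>w = p\<close> all cones and units are invertible and the same argument applies; only the
  construction of 2-cells differs. The case \<open>w = c\<close> is the case \<open>w = l\<close> with 2-cells reversed.\<close>

section \<open>Calculus in a strict 2-category\<close>

text \<open>The axioms are restated in terms of \<open>src\<close>, \<open>trg\<close>, \<open>dom2\<close> and \<open>cod2\<close>: in this form their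
  premises contain no variables beyond those of the conclusion, so that the simplifier can
  discharge them.\<close>

context two_category
begin

lemma src_trg_Obj [simp]:
  "f \<in> Mor A \<Longrightarrow> src A f \<in> Obj A" "f \<in> Mor A \<Longrightarrow> trg A f \<in> Obj A"
  using src_trg by auto

lemma id1_arr [simp]:
  assumes "X \<in> Obj A"
  shows "id1 A X \<in> Mor A" "src A (id1 A X) = X" "trg A (id1 A X) = X"
  using id1_hom[OF assms] by (auto simp: hom1_def)

lemma comp1_arr [simp]:
  assumes "f \<in> Mor A" "g \<in> Mor A" "trg A f = src A g"
  shows "g \<odot> f \<in> Mor A" "src A (g \<odot> f) = src A f" "trg A (g \<odot> f) = trg A g"
  using comp1_hom[of f "src A f" "src A g" g "trg A g"] assms by (auto simp: hom1_def)

lemma comp1_unit [simp]: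
  assumes "f \<in> Mor A"
  shows "trg A f = Y \<Longrightarrow> id1 A Y \<odot> f = f" "src A f = X \<Longrightarrow> f \<odot> id1 A X = f"
  using assms comp1_id_left[of f "src A f" "trg A f"] comp1_id_right[of f "src A f" "trg A f"]
  by (auto simp: hom1_def)

lemma comp1_ass:
  assumes "f \<in> Mor A" "g \<in> Mor A" "h \<in> Mor A" "trg A f = src A g" "trg A g = src A h"
  shows "(h \<odot> g) \<odot> f = h \<odot> (g \<odot> f)"
  using comp1_assoc[of f "src A f" "src A g" g "src A h" h "trg A h"] assms
  by (auto simp: hom1_def)

lemma comp1_left_eq:
  assumes "h \<odot> g = k" "f \<in> Mor A" "g \<in> Mor A" "h \<in> Mor A" "trg A f = src A g" "trg A g = src A h"
  shows "h \<odot> (g \<odot> f) = k \<odot> f"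
  using assms comp1_ass by metis

lemma cell_arr [simp]:
  assumes "\<alpha> \<in> Cell A"
  shows "dom2 A \<alpha> \<in> Mor A" "cod2 A \<alpha> \<in> Mor A"
    "src A (cod2 A \<alpha>) = src A (dom2 A \<alpha>)" "trg A (cod2 A \<alpha>) = trg A (dom2 A \<alpha>)"
  using dom_cod[OF assms] by auto

lemma id2_arr [simp]:
  assumes "f \<in> Mor A"
  shows "id2 A f \<in> Cell A" "dom2 A (id2 A f) = f" "cod2 A (id2 A f) = f"
  using id2_hom[OF assms] by (auto simp: hom2_def)

lemma vcomp_arr [simp]:
  assumes "\<alpha> \<in> Cell A" "\<beta> \<in> Cell A" "cod2 A \<alpha> = dom2 A \<beta>"
  shows "\<beta> \<bullet> \<alpha> \<in> Cell A" "dom2 A (\<beta> \<bullet> \<alpha>) = dom2 A \<alpha>" "cod2 A (\<beta> \<bullet> \<alpha>) = cod2 A \<beta>"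
  using vcomp_hom[of \<alpha> "dom2 A \<alpha>" "dom2 A \<beta>" \<beta> "cod2 A \<beta>"] assms by (auto simp: hom2_def)

lemma vcomp_unit [simp]:
  assumes "\<alpha> \<in> Cell A"
  shows "cod2 A \<alpha> = g \<Longrightarrow> id2 A g \<bullet> \<alpha> = \<alpha>" "dom2 A \<alpha> = f \<Longrightarrow> \<alpha> \<bullet> id2 A f = \<alpha>"
  using assms vcomp_id_left[of \<alpha> "dom2 A \<alpha>" "cod2 A \<alpha>"]
    vcomp_id_right[of \<alpha> "dom2 A \<alpha>" "cod2 A \<alpha>"]
  by (auto simp: hom2_def)

lemma vcomp_ass:
  assumes "\<alpha> \<in> Cell A" "\<beta> \<in> Cell A" "\<gamma> \<in> Cell A" "cod2 A \<alpha> = dom2 A \<beta>" "cod2 A \<beta> = dom2 A \<gamma>"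
  shows "(\<gamma> \<bullet> \<beta>) \<bullet> \<alpha> = \<gamma> \<bullet> (\<beta> \<bullet> \<alpha>)"
  using vcomp_assoc[of \<alpha> "dom2 A \<alpha>" "dom2 A \<beta>" \<beta> "dom2 A \<gamma>" \<gamma> "cod2 A \<gamma>"] assms
  by (auto simp: hom2_def)

lemma hcomp_arr [simp]:
  assumes "\<alpha> \<in> Cell A" "\<beta> \<in> Cell A" "trg A (dom2 A \<alpha>) = src A (dom2 A \<beta>)"
  shows "\<beta> \<star> \<alpha> \<in> Cell A" "dom2 A (\<beta> \<star> \<alpha>) = dom2 A \<beta> \<odot> dom2 A \<alpha>"
    "cod2 A (\<beta> \<star> \<alpha>) = cod2 A \<beta> \<odot> cod2 A \<alpha>"
  using hcomp_hom[of \<alpha> "dom2 A \<alpha>" "cod2 A \<alpha>" \<beta> "dom2 A \<beta>" "cod2 A \<beta>"] assms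
  by (auto simp: hom2_def)

lemma hcomp_ass:
  assumes "\<alpha> \<in> Cell A" "\<beta> \<in> Cell A" "\<gamma> \<in> Cell A"
    "trg A (dom2 A \<alpha>) = src A (dom2 A \<beta>)" "trg A (dom2 A \<beta>) = src A (dom2 A \<gamma>)"
  shows "(\<gamma> \<star> \<beta>) \<star> \<alpha> = \<gamma> \<star> (\<beta> \<star> \<alpha>)"
  using hcomp_assoc[of \<alpha> "dom2 A \<alpha>" "cod2 A \<alpha>" \<beta> "dom2 A \<beta>" "cod2 A \<beta>" \<gamma> "dom2 A \<gamma>" "cod2 A \<gamma>"]
    assms by (auto simp: hom2_def)

lemma hcomp_id [simp]:
  assumes "f \<in> Mor A" "g \<in> Mor A" "trg A f = src A g"
  shows "id2 A g \<star> id2 A f = id2 A (g \<odot> f)"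
  using hcomp_id2[of f "src A f" "src A g" g "trg A g"] assms by (auto simp: hom1_def)

lemma hcomp_unit [simp]:
  assumes "\<alpha> \<in> Cell A"
  shows "trg A (dom2 A \<alpha>) = Y \<Longrightarrow> id2 A (id1 A Y) \<star> \<alpha> = \<alpha>"
    "src A (dom2 A \<alpha>) = X \<Longrightarrow> \<alpha> \<star> id2 A (id1 A X) = \<alpha>"
  using assms
    hcomp_id_left[of \<alpha> "dom2 A \<alpha>" "cod2 A \<alpha>" "src A (dom2 A \<alpha>)" "trg A (dom2 A \<alpha>)"]
    hcomp_id_right[of \<alpha> "dom2 A \<alpha>" "cod2 A \<alpha>" "src A (dom2 A \<alpha>)" "trg A (dom2 A \<alpha>)"]
  by (auto simp: hom1_def hom2_def)

lemma interchange_arr: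
  assumes "\<alpha> \<in> Cell A" "\<alpha>' \<in> Cell A" "\<beta> \<in> Cell A" "\<beta>' \<in> Cell A"
    "cod2 A \<alpha> = dom2 A \<alpha>'" "cod2 A \<beta> = dom2 A \<beta>'" "trg A (dom2 A \<alpha>) = src A (dom2 A \<beta>)"
  shows "(\<beta>' \<bullet> \<beta>) \<star> (\<alpha>' \<bullet> \<alpha>) = (\<beta>' \<star> \<alpha>') \<bullet> (\<beta> \<star> \<alpha>)"
  using interchange[of \<alpha> "dom2 A \<alpha>" "dom2 A \<alpha>'" \<alpha>' "cod2 A \<alpha>'" \<beta> "dom2 A \<beta>" "dom2 A \<beta>'" \<beta>' "cod2 A \<beta>'"]
    assms by (auto simp: hom2_def)

lemma lwhisk_vcomp:
  assumes "\<alpha> \<in> Cell A" "\<beta> \<in> Cell A" "f \<in> Mor A" "cod2 A \<alpha> = dom2 A \<beta>" "trg A (dom2 A \<alpha>) = src A f"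
  shows "id2 A f \<star> (\<beta> \<bullet> \<alpha>) = (id2 A f \<star> \<beta>) \<bullet> (id2 A f \<star> \<alpha>)"
  using interchange_arr[of \<alpha> \<beta> "id2 A f" "id2 A f"] assms by simp

lemma rwhisk_vcomp:
  assumes "\<alpha> \<in> Cell A" "\<beta> \<in> Cell A" "f \<in> Mor A" "cod2 A \<alpha> = dom2 A \<beta>" "trg A f = src A (dom2 A \<alpha>)"
  shows "(\<beta> \<bullet> \<alpha>) \<star> id2 A f = (\<beta> \<star> id2 A f) \<bullet> (\<alpha> \<star> id2 A f)"
  using interchange_arr[of "id2 A f" "id2 A f" \<alpha> \<beta>] assms by simp

lemma lwhisk_lwhisk:
  assumes "\<alpha> \<in> Cell A" "f \<in> Mor A" "g \<in> Mor A" "trg A (dom2 A \<alpha>) = src A f" "trg A f = src A g"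
  shows "id2 A g \<star> (id2 A f \<star> \<alpha>) = id2 A (g \<odot> f) \<star> \<alpha>"
  using hcomp_ass[of \<alpha> "id2 A f" "id2 A g"] assms by simp

lemma rwhisk_rwhisk:
  assumes "\<alpha> \<in> Cell A" "f \<in> Mor A" "g \<in> Mor A" "trg A g = src A (dom2 A \<alpha>)" "trg A f = src A g"
  shows "(\<alpha> \<star> id2 A g) \<star> id2 A f = \<alpha> \<star> id2 A (g \<odot> f)"
  using hcomp_ass[of "id2 A f" "id2 A g" \<alpha>] assms by simp

text \<open>Sliding two cells past each other: both sides equal \<open>\<beta> \<star> \<alpha>\<close>.\<close>

lemma whisker_exchange:
  assumes "\<alpha> \<in> Cell A" "\<beta> \<in> Cell A" "trg A (dom2 A \<alpha>) = src A (dom2 A \<beta>)"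
  shows "(\<beta> \<star> id2 A (cod2 A \<alpha>)) \<bullet> (id2 A (dom2 A \<beta>) \<star> \<alpha>)
    = (id2 A (cod2 A \<beta>) \<star> \<alpha>) \<bullet> (\<beta> \<star> id2 A (dom2 A \<alpha>))"
  using interchange_arr[of \<alpha> "id2 A (cod2 A \<alpha>)" "id2 A (dom2 A \<beta>)" \<beta>]
    interchange_arr[of "id2 A (dom2 A \<alpha>)" \<alpha> \<beta> "id2 A (cod2 A \<beta>)"] assms by simp

lemma invertible2D:
  assumes "invertible2 A \<alpha>"
  obtains \<beta> where "\<beta> \<in> Cell A" "dom2 A \<beta> = cod2 A \<alpha>" "cod2 A \<beta> = dom2 A \<alpha>"
    "\<beta> \<bullet> \<alpha> = id2 A (dom2 A \<alpha>)" "\<alpha> \<bullet> \<beta> = id2 A (cod2 A \<alpha>)"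
  using assms by (auto simp: invertible2_def hom2_def)

lemma invertible2I:
  assumes "\<alpha> \<in> Cell A" "\<beta> \<in> Cell A" "dom2 A \<beta> = cod2 A \<alpha>" "cod2 A \<beta> = dom2 A \<alpha>"
    "\<beta> \<bullet> \<alpha> = id2 A (dom2 A \<alpha>)" "\<alpha> \<bullet> \<beta> = id2 A (cod2 A \<alpha>)"
  shows "invertible2 A \<alpha>"
  using assms by (auto simp: invertible2_def hom2_def)

lemma invertible2_id: "f \<in> Mor A \<Longrightarrow> invertible2 A (id2 A f)"
  by (rule invertible2I[where \<beta> = "id2 A f"]) auto

lemma invertible2_lwhisk:
  assumes inv: "invertible2 A \<alpha>" and f: "f \<in> Mor A" "trg A (dom2 A \<alpha>) = src A f"
  shows "invertible2 A (id2 A f \<star> \<alpha>)"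
proof -
  have \<alpha>: "\<alpha> \<in> Cell A" using inv by (simp add: invertible2_def)
  obtain \<beta> where \<beta>: "\<beta> \<in> Cell A" "dom2 A \<beta> = cod2 A \<alpha>" "cod2 A \<beta> = dom2 A \<alpha>"
    "\<beta> \<bullet> \<alpha> = id2 A (dom2 A \<alpha>)" "\<alpha> \<bullet> \<beta> = id2 A (cod2 A \<alpha>)"
    using invertible2D[OF inv] .
  show ?thesis
    by (rule invertible2I[where \<beta> = "id2 A f \<star> \<beta>"])
      (use \<alpha> \<beta> f in \<open>simp_all flip: lwhisk_vcomp\<close>)
qed

lemma invertible2_rwhisk:
  assumes inv: "invertible2 A \<alpha>" and f: "f \<in> Mor A" "trg A f = src A (dom2 A \<alpha>)"
  shows "invertible2 A (\<alpha> \<star> id2 A f)"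
proof -
  have \<alpha>: "\<alpha> \<in> Cell A" using inv by (simp add: invertible2_def)
  obtain \<beta> where \<beta>: "\<beta> \<in> Cell A" "dom2 A \<beta> = cod2 A \<alpha>" "cod2 A \<beta> = dom2 A \<alpha>"
    "\<beta> \<bullet> \<alpha> = id2 A (dom2 A \<alpha>)" "\<alpha> \<bullet> \<beta> = id2 A (cod2 A \<alpha>)"
    using invertible2D[OF inv] .
  show ?thesis
    by (rule invertible2I[where \<beta> = "\<beta> \<star> id2 A f"])
      (use \<alpha> \<beta> f in \<open>simp_all flip: rwhisk_vcomp\<close>)
qed

lemma invertible2_vcomp:
  assumes inv: "invertible2 A \<alpha>" "invertible2 A \<beta>" and c: "cod2 A \<alpha> = dom2 A \<beta>"
  shows "invertible2 A (\<beta> \<bullet> \<alpha>)"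
proof -
  have ab: "\<alpha> \<in> Cell A" "\<beta> \<in> Cell A" using inv by (simp_all add: invertible2_def)
  obtain \<alpha>' where a': "\<alpha>' \<in> Cell A" "dom2 A \<alpha>' = cod2 A \<alpha>" "cod2 A \<alpha>' = dom2 A \<alpha>"
    "\<alpha>' \<bullet> \<alpha> = id2 A (dom2 A \<alpha>)" "\<alpha> \<bullet> \<alpha>' = id2 A (cod2 A \<alpha>)"
    using invertible2D[OF inv(1)] .
  obtain \<beta>' where b': "\<beta>' \<in> Cell A" "dom2 A \<beta>' = cod2 A \<beta>" "cod2 A \<beta>' = dom2 A \<beta>"
    "\<beta>' \<bullet> \<beta> = id2 A (dom2 A \<beta>)" "\<beta> \<bullet> \<beta>' = id2 A (cod2 A \<beta>)"
    using invertible2D[OF inv(2)] .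
  \<comment> \<open>The inverse of the composite is the composite \<open>\<alpha>' \<bullet> \<beta>'\<close> of the inverses.\<close>
  have "(\<alpha>' \<bullet> \<beta>') \<bullet> (\<beta> \<bullet> \<alpha>) = \<alpha>' \<bullet> ((\<beta>' \<bullet> \<beta>) \<bullet> \<alpha>)"
    using ab a'(1-3) b'(1-3) c by (simp add: vcomp_ass)
  then have 1: "(\<alpha>' \<bullet> \<beta>') \<bullet> (\<beta> \<bullet> \<alpha>) = id2 A (dom2 A \<alpha>)"
    using ab a' b' c by simp
  have "(\<beta> \<bullet> \<alpha>) \<bullet> (\<alpha>' \<bullet> \<beta>') = \<beta> \<bullet> ((\<alpha> \<bullet> \<alpha>') \<bullet> \<beta>')"
    using ab a'(1-3) b'(1-3) c by (simp add: vcomp_ass)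
  then have 2: "(\<beta> \<bullet> \<alpha>) \<bullet> (\<alpha>' \<bullet> \<beta>') = id2 A (cod2 A \<beta>)"
    using ab a' b' c by simp
  show ?thesis
    by (rule invertible2I[where \<beta> = "\<alpha>' \<bullet> \<beta>'"]) (use ab a' b' c 1 2 in simp_all)
qed

end

context two_functor
begin

lemma on1_arr [simp]:
  assumes "f \<in> Mor A"
  shows "on1 F f \<in> Mor B" "src B (on1 F f) = on0 F (src A f)" "trg B (on1 F f) = on0 F (trg A f)"
  using on1_hom[of f "src A f" "trg A f"] assms by (auto simp: hom1_def)

lemma on1_comp:
  assumes "f \<in> Mor A" "g \<in> Mor A" "trg A f = src A g"
  shows "on1 F (g \<odot>\<^bsub>A\<^esub> f) = on1 F g \<odot>\<^bsub>B\<^esub> on1 F f"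
  using on1_comp1[of f "src A f" "src A g" g "trg A g"] assms by (auto simp: hom1_def)

lemma on2_arr [simp]:
  assumes "\<alpha> \<in> Cell A"
  shows "on2 F \<alpha> \<in> Cell B" "dom2 B (on2 F \<alpha>) = on1 F (dom2 A \<alpha>)"
    "cod2 B (on2 F \<alpha>) = on1 F (cod2 A \<alpha>)"
  using on2_hom[of \<alpha> "dom2 A \<alpha>" "cod2 A \<alpha>"] assms by (auto simp: hom2_def)

lemma on2_vcomp_arr:
  assumes "\<alpha> \<in> Cell A" "\<beta> \<in> Cell A" "cod2 A \<alpha> = dom2 A \<beta>"
  shows "on2 F (\<beta> \<bullet>\<^bsub>A\<^esub> \<alpha>) = on2 F \<beta> \<bullet>\<^bsub>B\<^esub> on2 F \<alpha>"
  using on2_vcomp[of \<alpha> "dom2 A \<alpha>" "dom2 A \<beta>" \<beta> "cod2 A \<beta>"] assms by (auto simp: hom2_def)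

lemma on2_hcomp_arr:
  assumes "\<alpha> \<in> Cell A" "\<beta> \<in> Cell A" "trg A (dom2 A \<alpha>) = src A (dom2 A \<beta>)"
  shows "on2 F (\<beta> \<star>\<^bsub>A\<^esub> \<alpha>) = on2 F \<beta> \<star>\<^bsub>B\<^esub> on2 F \<alpha>"
  using on2_hcomp[of \<alpha> "dom2 A \<alpha>" "cod2 A \<alpha>" \<beta> "dom2 A \<beta>" "cod2 A \<beta>"] assms
  by (auto simp: hom2_def)

lemma on2_invertible:
  assumes "invertible2 A \<alpha>"
  shows "invertible2 B (on2 F \<alpha>)"
proof -
  have \<alpha>: "\<alpha> \<in> Cell A" using assms by (simp add: invertible2_def)
  obtain \<beta> where \<beta>: "\<beta> \<in> Cell A" "dom2 A \<beta> = cod2 A \<alpha>" "cod2 A \<beta> = dom2 A \<alpha>"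
    "\<beta> \<bullet>\<^bsub>A\<^esub> \<alpha> = id2 A (dom2 A \<alpha>)" "\<alpha> \<bullet>\<^bsub>A\<^esub> \<beta> = id2 A (cod2 A \<alpha>)"
    using A.invertible2D[OF assms] .
  show ?thesis
    by (rule B.invertible2I[where \<beta> = "on2 F \<beta>"])
      (use \<alpha> \<beta> in \<open>simp_all add: on2_id2 flip: on2_vcomp_arr\<close>)
qed

end


section \<open>Reflections\<close>

text \<open>An adjunction with identity counit, the triangle identities being simplified accordingly
  (see \<open>adjunction_id_counit_iff\<close>).\<close>

definition reflection :: "('o, 'm, 'c) two_cat \<Rightarrow> 'm \<Rightarrow> 'm \<Rightarrow> 'c \<Rightarrow> bool" where
  "reflection A f g \<eta> \<longleftrightarrow> f \<in> Mor A \<and> g \<in> Mor A \<and> \<eta> \<in> Cell A \<and>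
     src A g = trg A f \<and> trg A g = src A f \<and> f \<odot>\<^bsub>A\<^esub> g = id1 A (trg A f) \<and>
     dom2 A \<eta> = id1 A (src A f) \<and> cod2 A \<eta> = g \<odot>\<^bsub>A\<^esub> f \<and>
     lwhisk A f \<eta> = id2 A f \<and> rwhisk A \<eta> g = id2 A g"

context two_category
begin

lemma adjunction_id_counit_iff:
  assumes f: "f \<in> Mor A"
  shows "adjunction A (id2 A (id1 A (trg A f))) f g \<eta> \<longleftrightarrow> reflection A f g \<eta>"
proof
  assume "adjunction A (id2 A (id1 A (trg A f))) f g \<eta>"
  then obtain X Y where h: "f \<in> hom1 A X Y" "g \<in> hom1 A Y X" "\<eta> \<in> hom2 A (id1 A X) (g \<odot> f)"
      "id2 A (id1 A (trg A f)) \<in> hom2 A (f \<odot> g) (id1 A Y)"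
    and t: "rwhisk A (id2 A (id1 A (trg A f))) f \<bullet> lwhisk A f \<eta> = id2 A f"
      "lwhisk A g (id2 A (id1 A (trg A f))) \<bullet> rwhisk A \<eta> g = id2 A g"
    unfolding adjunction_def by blast
  have a: "g \<in> Mor A" "\<eta> \<in> Cell A" "src A g = trg A f" "trg A g = src A f"
      "dom2 A \<eta> = id1 A (src A f)" "cod2 A \<eta> = g \<odot> f"
    using h(1-3) by (auto simp: hom1_def hom2_def)
  have fg: "f \<odot> g = id1 A (trg A f)"
    using h(4) f by (simp add: hom2_def)
  have "id2 A f \<star> \<eta> = id2 A f"
    using t(1) f a by (simp add: comp1_left_eq[OF fg])
  moreover have "\<eta> \<star> id2 A g = id2 A g"
    using t(2) f a by (simp add: comp1_ass fg)
  ultimately show "reflection A f g \<eta>"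
    using f a fg by (simp add: reflection_def)
next
  assume "reflection A f g \<eta>"
  then show "adjunction A (id2 A (id1 A (trg A f))) f g \<eta>"
    unfolding adjunction_def
    by (intro exI[of _ "src A f"] exI[of _ "trg A f"])
      (auto simp: reflection_def hom1_def hom2_def)
qed

lemma reflection_comp:
  assumes 1: "reflection A f1 g1 \<eta>1" and 2: "reflection A f2 g2 \<eta>2" and c: "trg A f1 = src A f2"
  shows "reflection A (f2 \<odot> f1) (g1 \<odot> g2) (((id2 A g1 \<star> \<eta>2) \<star> id2 A f1) \<bullet> \<eta>1)"
proof -
  note r1 = 1[unfolded reflection_def] and r2 = 2[unfolded reflection_def]
  have a1: "f1 \<in> Mor A" "g1 \<in> Mor A" "\<eta>1 \<in> Cell A" "src A g1 = trg A f1" "trg A g1 = src A f1"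
    "dom2 A \<eta>1 = id1 A (src A f1)" "cod2 A \<eta>1 = g1 \<odot> f1" using r1 by auto
  have a2: "f2 \<in> Mor A" "g2 \<in> Mor A" "\<eta>2 \<in> Cell A" "src A g2 = trg A f2" "trg A g2 = src A f2"
    "dom2 A \<eta>2 = id1 A (src A f2)" "cod2 A \<eta>2 = g2 \<odot> f2" using r2 by auto
  have t1: "f1 \<odot> g1 = id1 A (trg A f1)" "id2 A f1 \<star> \<eta>1 = id2 A f1" "\<eta>1 \<star> id2 A g1 = id2 A g1"
    using r1 by auto
  have t2: "f2 \<odot> g2 = id1 A (trg A f2)" "id2 A f2 \<star> \<eta>2 = id2 A f2" "\<eta>2 \<star> id2 A g2 = id2 A g2"
    using r2 by auto
  note a = a1 a2 c
  \<comment> \<open>The triangle identities for \<open>\<eta>2\<close>, whiskered on the far side by the adjoint of the first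
    reflection, make \<open>\<mu>\<close> disappear because \<open>f1 g1 = 1\<close>; those for \<open>\<eta>1\<close> remain.\<close>
  let ?\<mu> = "(id2 A g1 \<star> \<eta>2) \<star> id2 A f1"
  have \<mu>: "?\<mu> \<in> Cell A" "dom2 A ?\<mu> = g1 \<odot> f1" "cod2 A ?\<mu> = (g1 \<odot> g2) \<odot> (f2 \<odot> f1)"
    using a by (simp_all add: comp1_ass)
  have fg: "(f2 \<odot> f1) \<odot> (g1 \<odot> g2) = id1 A (trg A f2)"
  proof -
    have "(f2 \<odot> f1) \<odot> (g1 \<odot> g2) = f2 \<odot> ((f1 \<odot> g1) \<odot> g2)"
      using a by (simp add: comp1_ass)
    then show ?thesis using a t1(1) t2(1) by simp
  qed
  have "id2 A (f2 \<odot> f1) \<star> ?\<mu> = ((id2 A f2 \<star> ((id2 A f1 \<star> id2 A g1) \<star> \<eta>2)) \<star> id2 A f1)"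
  proof -
    have "id2 A (f2 \<odot> f1) \<star> ?\<mu> = (id2 A f2 \<star> id2 A f1) \<star> ?\<mu>" using a by simp
    also have "\<dots> = ((id2 A f2 \<star> ((id2 A f1 \<star> id2 A g1) \<star> \<eta>2)) \<star> id2 A f1)"
      using a by (simp add: hcomp_ass comp1_ass del: hcomp_id)
    finally show ?thesis .
  qed
  also have "\<dots> = id2 A (f2 \<odot> f1)"
    using a t1(1) t2(2) by simp
  finally have w: "id2 A (f2 \<odot> f1) \<star> ?\<mu> = id2 A (f2 \<odot> f1)" .
  have "id2 A (f2 \<odot> f1) \<star> \<eta>1 = id2 A f2 \<star> (id2 A f1 \<star> \<eta>1)"
    using a by (simp add: lwhisk_lwhisk)
  then have w': "id2 A (f2 \<odot> f1) \<star> \<eta>1 = id2 A (f2 \<odot> f1)"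
    using a t1(2) by simp
  have l: "id2 A (f2 \<odot> f1) \<star> (?\<mu> \<bullet> \<eta>1) = id2 A (f2 \<odot> f1)"
    using a \<mu> w w' by (simp add: lwhisk_vcomp)
  have "?\<mu> \<star> id2 A (g1 \<odot> g2) = id2 A g1 \<star> (\<eta>2 \<star> (id2 A (f1 \<odot> g1) \<star> id2 A g2))"
  proof -
    have "?\<mu> \<star> id2 A (g1 \<odot> g2) = ?\<mu> \<star> (id2 A g1 \<star> id2 A g2)" using a by simp
    also have "\<dots> = id2 A g1 \<star> (\<eta>2 \<star> ((id2 A f1 \<star> id2 A g1) \<star> id2 A g2))"
      using a by (simp add: hcomp_ass comp1_ass del: hcomp_id)
    also have "\<dots> = id2 A g1 \<star> (\<eta>2 \<star> (id2 A (f1 \<odot> g1) \<star> id2 A g2))" using a by simp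
    finally show ?thesis .
  qed
  then have v: "?\<mu> \<star> id2 A (g1 \<odot> g2) = id2 A (g1 \<odot> g2)"
    using a t1(1) t2(3) by simp
  have "\<eta>1 \<star> id2 A (g1 \<odot> g2) = (\<eta>1 \<star> id2 A g1) \<star> id2 A g2"
    using a by (simp add: rwhisk_rwhisk)
  then have v': "\<eta>1 \<star> id2 A (g1 \<odot> g2) = id2 A (g1 \<odot> g2)"
    using a t1(3) by simp
  have r: "(?\<mu> \<bullet> \<eta>1) \<star> id2 A (g1 \<odot> g2) = id2 A (g1 \<odot> g2)"
    using a \<mu> v v' by (simp add: rwhisk_vcomp)
  show ?thesis
    unfolding reflection_def using a \<mu> fg l r by simp
qed

end

lemma (in two_functor) on_reflection:
  assumes "reflection A f g \<eta>"
  shows "reflection B (on1 F f) (on1 F g) (on2 F \<eta>)"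
proof -
  note r = assms[unfolded reflection_def]
  have "on1 F f \<odot>\<^bsub>B\<^esub> on1 F g = on1 F (id1 A (trg A f))"
    using r by (metis on1_comp)
  moreover have "lwhisk B (on1 F f) (on2 F \<eta>) = on2 F (id2 A f)"
    "rwhisk B (on2 F \<eta>) (on1 F g) = on2 F (id2 A g)"
    using r on2_hcomp_arr[of \<eta> "id2 A f"] on2_hcomp_arr[of "id2 A g" \<eta>]
    by (auto simp: on2_id2)
  ultimately show ?thesis
    using r by (auto simp: reflection_def on1_id1 on1_comp on2_id2)
qed

section \<open>Tight morphisms and w-reflections\<close>

text \<open>The lax and the pseudo case are treated together: they differ by the invertibility of units
  and of the 2-cells of cones.\<close>

definition w_reflection ::
    "laxity \<Rightarrow> ('o, 'm, 'c, 'n, 'd) F_cat \<Rightarrow> 'n \<Rightarrow> 'n \<Rightarrow> 'd \<Rightarrow> bool" where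
  "w_reflection w A f g \<eta> \<longleftrightarrow> l_reflection A f g \<eta> \<and> (w = Pseudo \<longrightarrow> invertible2 (loose A) \<eta>)"

definition w_cone ::
    "laxity \<Rightarrow> ('o, 'm, 'c, 'n, 'd) F_cat \<Rightarrow> 'n \<Rightarrow> 'o \<Rightarrow> 'n \<Rightarrow> 'd \<Rightarrow> 'n \<Rightarrow> bool" where
  "w_cone w A f X r \<alpha> s \<longleftrightarrow> colax_cone A f X r \<alpha> s \<and> (w = Pseudo \<longrightarrow> invertible2 (loose A) \<alpha>)"

lemma w_Refl_lift:
  assumes "w \<noteq> Colax" "w_Refl w A B H" "is_tight A f" "w_reflection w B (on1 H f) g \<eta>"
  shows "\<exists>!(g', \<eta>'). w_reflection w A f g' \<eta>' \<and> on1 H g' = g \<and> on2 H \<eta>' = \<eta>"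
  using assms by (cases w) (simp_all add: w_reflection_def l_Refl_def p_Refl_def p_reflection_def)

lemma w_Morph_iff:
  assumes "w \<noteq> Colax" "w_Morph w A B H" "w_reflection w A f1 g1 \<eta>1" "w_reflection w A f2 g2 \<eta>2"
    "tight_square A f1 f2 r s"
  shows "refl_morphism A f1 g1 \<eta>1 f2 g2 \<eta>2 r s \<longleftrightarrow>
      refl_morphism B (on1 H f1) (on1 H g1) (on2 H \<eta>1) (on1 H f2) (on1 H g2) (on2 H \<eta>2)
        (on1 H r) (on1 H s)"
  using assms by (cases w) (simp_all add: w_reflection_def l_Morph_def p_Morph_def p_reflection_def)

locale F_category_locale = two_category L for L :: "('o, 'n, 'd) two_cat" (structure) +
  fixes A :: "('o, 'm, 'c, 'n, 'd) F_cat"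
  assumes F_category: "F_category A" and L_def: "L = loose A"
begin

sublocale incl: two_functor "tight A" L "incl A"
  using F_category by (simp add: F_category_def L_def)

lemma Obj_tight: "Obj (tight A) = Obj L"
  using F_category by (simp add: F_category_def L_def)

lemma on0_incl [simp]: "X \<in> Obj L \<Longrightarrow> on0 (incl A) X = X"
  using F_category by (simp add: F_category_def L_def)

lemma incl_inj: "inj_on (on1 (incl A)) (Mor (tight A))"
  using F_category by (simp add: F_category_def)

lemma tight_Mor [simp]: "is_tight A f \<Longrightarrow> f \<in> Mor L"
  by (auto simp: is_tight_def)

definition as_tight :: "'n \<Rightarrow> 'm" where
  "as_tight f = inv_into (Mor (tight A)) (on1 (incl A)) f"

lemma as_tight_arr [simp]:
  assumes "is_tight A f"
  shows "as_tight f \<in> Mor (tight A)" "on1 (incl A) (as_tight f) = f"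
    "src (tight A) (as_tight f) = src L f" "trg (tight A) (as_tight f) = trg L f"
proof -
  have im: "f \<in> on1 (incl A) ` Mor (tight A)" using assms by (simp add: is_tight_def)
  show m: "as_tight f \<in> Mor (tight A)" unfolding as_tight_def by (rule inv_into_into[OF im])
  show e: "on1 (incl A) (as_tight f) = f" unfolding as_tight_def by (rule f_inv_into_f[OF im])
  show "src (tight A) (as_tight f) = src L f" "trg (tight A) (as_tight f) = trg L f"
    using incl.on1_arr(2,3)[OF m] e m by (simp_all flip: Obj_tight)
qed

lemma as_tight_incl [simp]: "f \<in> Mor (tight A) \<Longrightarrow> as_tight (on1 (incl A) f) = f"
  unfolding as_tight_def by (rule inv_into_f_f[OF incl_inj])

lemma is_tight_incl [simp]: "f \<in> Mor (tight A) \<Longrightarrow> is_tight A (on1 (incl A) f)"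
  by (simp add: is_tight_def)

lemma
  assumes "X \<in> Obj L"
  shows tight_id [simp]: "is_tight A (id1 L X)" and as_tight_id: "as_tight (id1 L X) = id1 (tight A) X"
proof -
  have "on1 (incl A) (id1 (tight A) X) = id1 L X"
    using assms incl.on1_id1[of X] by (simp add: Obj_tight)
  then show "is_tight A (id1 L X)" "as_tight (id1 L X) = id1 (tight A) X"
    using assms is_tight_incl[of "id1 (tight A) X"] as_tight_incl[of "id1 (tight A) X"]
    by (simp_all add: Obj_tight)
qed

lemma
  assumes "is_tight A f" "is_tight A g" "trg L f = src L g"
  shows tight_comp [simp]: "is_tight A (g \<odot> f)" and as_tight_comp: "as_tight (g \<odot> f) = as_tight g \<odot>\<^bsub>tight A\<^esub> as_tight f"
proof -
  have m: "as_tight g \<odot>\<^bsub>tight A\<^esub> as_tight f \<in> Mor (tight A)"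
    using assms by simp
  have "on1 (incl A) (as_tight g \<odot>\<^bsub>tight A\<^esub> as_tight f) = g \<odot> f"
    using assms by (simp add: incl.on1_comp)
  then show "is_tight A (g \<odot> f)" "as_tight (g \<odot> f) = as_tight g \<odot>\<^bsub>tight A\<^esub> as_tight f"
    using is_tight_incl[OF m] as_tight_incl[OF m] by simp_all
qed

text \<open>This is the local fullness of the inclusion, which allows \<open>R\<close> to be applied to 2-cells of the
  loose 2-category between tight morphisms.\<close>

lemma tight_cell:
  assumes "\<beta> \<in> Cell L" "is_tight A (dom2 L \<beta>)" "is_tight A (cod2 L \<beta>)"
  obtains \<gamma> where "\<gamma> \<in> Cell (tight A)" "on2 (incl A) \<gamma> = \<beta>"
    "dom2 (tight A) \<gamma> = as_tight (dom2 L \<beta>)" "cod2 (tight A) \<gamma> = as_tight (cod2 L \<beta>)"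
proof -
  let ?f = "as_tight (dom2 L \<beta>)" and ?g = "as_tight (cod2 L \<beta>)"
  let ?X = "src L (dom2 L \<beta>)" and ?Y = "trg L (dom2 L \<beta>)"
  have "?f \<in> hom1 (tight A) ?X ?Y" "?g \<in> hom1 (tight A) ?X ?Y"
    using assms by (simp_all add: hom1_def)
  then have "bij_betw (on2 (incl A)) (hom2 (tight A) ?f ?g)
      (hom2 L (on1 (incl A) ?f) (on1 (incl A) ?g))"
    using F_category unfolding F_category_def L_def by blast
  moreover have "\<beta> \<in> hom2 L (on1 (incl A) ?f) (on1 (incl A) ?g)"
    using assms by (simp add: hom2_def)
  ultimately obtain \<gamma> where "\<gamma> \<in> hom2 (tight A) ?f ?g" "on2 (incl A) \<gamma> = \<beta>"
    unfolding bij_betw_def by (metis imageE)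
  then show thesis using that unfolding hom2_def by blast
qed

lemma w_reflection_iff:
  "w_reflection w A f g \<eta> \<longleftrightarrow>
    is_tight A f \<and> reflection L f g \<eta> \<and> (w = Pseudo \<longrightarrow> invertible2 L \<eta>)"
  using adjunction_id_counit_iff[of f g \<eta>] tight_Mor[of f]
  unfolding w_reflection_def l_reflection_def L_def[symmetric] by blast

lemma w_reflection_id:
  assumes "X \<in> Obj L"
  shows "w_reflection w A (id1 L X) (id1 L X) (id2 L (id1 L X))"
  using assms by (simp add: w_reflection_iff reflection_def invertible2_id)

lemma w_reflection_comp:
  assumes 1: "w_reflection w A f1 g1 \<eta>1" and 2: "w_reflection w A f2 g2 \<eta>2"
    and c: "trg L f1 = src L f2"
  shows "w_reflection w A (f2 \<odot> f1) (g1 \<odot> g2) (((id2 L g1 \<star> \<eta>2) \<star> id2 L f1) \<bullet> \<eta>1)"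
proof -
  have r: "reflection L f1 g1 \<eta>1" "reflection L f2 g2 \<eta>2"
    using 1 2 by (simp_all add: w_reflection_iff)
  have "invertible2 L (((id2 L g1 \<star> \<eta>2) \<star> id2 L f1) \<bullet> \<eta>1)" if "w = Pseudo"
    using 1 2 c that r
    by (intro invertible2_vcomp invertible2_rwhisk invertible2_lwhisk)
      (auto simp: w_reflection_iff reflection_def)
  then show ?thesis
    using 1 2 c reflection_comp[OF r c] by (simp add: w_reflection_iff)
qed

lemma refl_morphism_iff:
  assumes "reflection L f1 g1 \<eta>1" "reflection L f2 g2 \<eta>2"
  shows "refl_morphism A f1 g1 \<eta>1 f2 g2 \<eta>2 r s \<longleftrightarrow>
     is_tight A f1 \<and> is_tight A f2 \<and> is_tight A r \<and> is_tight A s \<and>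
     src L r = src L f1 \<and> trg L r = src L f2 \<and> src L s = trg L f1 \<and> trg L s = trg L f2 \<and>
     f2 \<odot> r = s \<odot> f1 \<and> g2 \<odot> s = r \<odot> g1 \<and> id2 L r \<star> \<eta>1 = \<eta>2 \<star> id2 L r"
  unfolding refl_morphism_def tight_square_def L_def[symmetric] hom1_def by auto

end

section \<open>The reflection carried by a limit of a loose morphism\<close>

locale loose_limit = F_category_locale L A
  for L :: "('o, 'n, 'd) two_cat" (structure) and A :: "('o, 'm, 'c, 'n, 'd) F_cat" +
  fixes w :: laxity and f :: 'n and C :: 'o and p :: 'n and l :: 'd and q :: 'n
  assumes f_Mor [simp]: "f \<in> Mor L"
    and limit: "cone_limit A (w_cone w A f) f C p l q"
begin

lemma cone_arr [simp]:
  "is_tight A p" "is_tight A q" "src L p = C" "src L q = C" "trg L p = src L f" "trg L q = trg L f"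
  "l \<in> Cell L" "dom2 L l = q" "cod2 L l = f \<odot> p" "C \<in> Obj L"
  using limit src_trg_Obj(1)[of p]
  by (auto simp: cone_limit_def w_cone_def colax_cone_def hom1_def hom2_def simp flip: L_def)

lemma cone_invertible: "w = Pseudo \<Longrightarrow> invertible2 L l"
  using limit by (simp add: cone_limit_def w_cone_def L_def)

lemma w_cone_iff:
  "w_cone w A f X r \<alpha> s \<longleftrightarrow> r \<in> Mor L \<and> s \<in> Mor L \<and> \<alpha> \<in> Cell L \<and> src L r = X \<and> src L s = X \<and>
     trg L r = src L f \<and> trg L s = trg L f \<and> dom2 L \<alpha> = s \<and> cod2 L \<alpha> = f \<odot> r \<and>
     (w = Pseudo \<longrightarrow> invertible2 L \<alpha>)"
  by (auto simp: w_cone_def colax_cone_def hom1_def hom2_def simp flip: L_def)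

lemma cone_factor:
  assumes "w_cone w A f X r \<alpha> s"
  obtains t where "t \<in> Mor L" "src L t = X" "trg L t = C" "p \<odot> t = r" "q \<odot> t = s"
    "l \<star> id2 L t = \<alpha>"
proof -
  have "\<exists>!t. factors_cone L C p l q X r \<alpha> s t"
    using limit assms unfolding cone_limit_def L_def by blast
  then show thesis using that by (auto simp: factors_cone_def hom1_def)
qed

text \<open>Every morphism into \<open>C\<close> is the one induced by its own composites with the limit cone; the
  universal properties can therefore be stated for such morphisms instead of for cones.\<close>

lemma cone_precomp:
  assumes "t \<in> Mor L" "trg L t = C"
  shows "w_cone w A f (src L t) (p \<odot> t) (l \<star> id2 L t) (q \<odot> t)"
  using assms cone_invertible by (simp add: w_cone_iff comp1_ass invertible2_rwhisk)

lemma cone_factor_unique: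
  assumes "t \<in> Mor L" "trg L t = C" "t' \<in> Mor L" "trg L t' = C"
    and "p \<odot> t = p \<odot> t'" "q \<odot> t = q \<odot> t'" "l \<star> id2 L t = l \<star> id2 L t'"
  shows "t = t'"
proof -
  have s: "src L t = src L t'"
    using assms comp1_arr(2)[of t p] comp1_arr(2)[of t' p] by simp
  have "\<exists>!u. factors_cone L C p l q (src L t) (p \<odot> t) (l \<star> id2 L t) (q \<odot> t) u"
    using limit cone_precomp[OF assms(1,2)] unfolding cone_limit_def L_def by blast
  moreover have "factors_cone L C p l q (src L t) (p \<odot> t) (l \<star> id2 L t) (q \<odot> t) t"
    "factors_cone L C p l q (src L t) (p \<odot> t) (l \<star> id2 L t) (q \<odot> t) t'"
    using assms s by (simp_all add: factors_cone_def hom1_def)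
  ultimately show ?thesis by blast
qed

lemma cell_factor:
  assumes t: "t \<in> Mor L" "trg L t = C" "t' \<in> Mor L" "trg L t' = C" "src L t' = src L t"
    and r: "\<theta>r \<in> Cell L" "dom2 L \<theta>r = p \<odot> t" "cod2 L \<theta>r = p \<odot> t'"
    and s: "\<theta>s \<in> Cell L" "dom2 L \<theta>s = q \<odot> t" "cod2 L \<theta>s = q \<odot> t'"
    and eq: "(l \<star> id2 L t') \<bullet> \<theta>s = (id2 L f \<star> \<theta>r) \<bullet> (l \<star> id2 L t)"
  shows "\<exists>!\<phi>. \<phi> \<in> Cell L \<and> dom2 L \<phi> = t \<and> cod2 L \<phi> = t' \<and> id2 L p \<star> \<phi> = \<theta>r \<and> id2 L q \<star> \<phi> = \<theta>s"
proof -
  let ?X = "src L t"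
  have c: "w_cone w A f ?X (p \<odot> t) (l \<star> id2 L t) (q \<odot> t)"
    "w_cone w A f ?X (p \<odot> t') (l \<star> id2 L t') (q \<odot> t')"
    using cone_precomp[of t] cone_precomp[of t'] t by simp_all
  have h: "\<theta>r \<in> hom2 L (p \<odot> t) (p \<odot> t')" "\<theta>s \<in> hom2 L (q \<odot> t) (q \<odot> t')"
    using r s by (simp_all add: hom2_def)
  have fc: "factors_cone L C p l q ?X (p \<odot> t) (l \<star> id2 L t) (q \<odot> t) t"
    "factors_cone L C p l q ?X (p \<odot> t') (l \<star> id2 L t') (q \<odot> t') t'"
    using t by (simp_all add: factors_cone_def hom1_def)
  have "\<forall>X r \<alpha> s r' \<alpha>' s' t t'. \<forall>\<theta>\<^sub>r \<in> hom2 L r r'. \<forall>\<theta>\<^sub>s \<in> hom2 L s s'.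
        w_cone w A f X r \<alpha> s \<and> w_cone w A f X r' \<alpha>' s' \<and>
        factors_cone L C p l q X r \<alpha> s t \<and>
        factors_cone L C p l q X r' \<alpha>' s' t' \<and>
        \<alpha>' \<bullet> \<theta>\<^sub>s = lwhisk L f \<theta>\<^sub>r \<bullet> \<alpha> \<longrightarrow>
        (\<exists>!\<phi>. \<phi> \<in> hom2 L t t' \<and> lwhisk L p \<phi> = \<theta>\<^sub>r \<and> lwhisk L q \<phi> = \<theta>\<^sub>s)"
    using limit unfolding cone_limit_def L_def by blast
  then have "\<exists>!\<phi>. \<phi> \<in> hom2 L t t' \<and> lwhisk L p \<phi> = \<theta>r \<and> lwhisk L q \<phi> = \<theta>s"
    using c h fc eq by blast
  then show ?thesis by (simp add: hom2_def)
qed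

text \<open>The projections are jointly faithful on 2-cells into \<open>C\<close>: by interchange, whiskering any
  2-cell into \<open>C\<close> gives compatible data for the two-dimensional universal property.\<close>

lemma cell_eqI:
  assumes \<phi>: "\<phi> \<in> Cell L" "trg L (dom2 L \<phi>) = C"
    and \<psi>: "\<psi> \<in> Cell L" "dom2 L \<psi> = dom2 L \<phi>" "cod2 L \<psi> = cod2 L \<phi>"
    and eq: "id2 L p \<star> \<phi> = id2 L p \<star> \<psi>" "id2 L q \<star> \<phi> = id2 L q \<star> \<psi>"
  shows "\<phi> = \<psi>"
proof -
  have "(l \<star> id2 L (cod2 L \<phi>)) \<bullet> (id2 L q \<star> \<phi>) =
      (id2 L f \<star> (id2 L p \<star> \<phi>)) \<bullet> (l \<star> id2 L (dom2 L \<phi>))"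
    using whisker_exchange[of \<phi> l] \<phi> by (simp add: lwhisk_lwhisk)
  then have "\<exists>!\<chi>. \<chi> \<in> Cell L \<and> dom2 L \<chi> = dom2 L \<phi> \<and> cod2 L \<chi> = cod2 L \<phi> \<and>
      id2 L p \<star> \<chi> = id2 L p \<star> \<phi> \<and> id2 L q \<star> \<chi> = id2 L q \<star> \<phi>"
    using \<phi> by (intro cell_factor) simp_all
  then show ?thesis using \<phi> \<psi> eq by metis
qed

lemma tight_iff:
  assumes "t \<in> Mor L" "trg L t = C"
  shows "is_tight A t \<longleftrightarrow> is_tight A (p \<odot> t) \<and> is_tight A (q \<odot> t)"
proof -
  have "t \<in> hom1 L (src L t) C" using assms by (simp add: hom1_def)
  then show ?thesis using limit unfolding cone_limit_def L_def by blast
qed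

text \<open>The cone \<open>(1, id, f)\<close> induces the section \<open>d\<close>; the pair \<open>(id\<^bsub>p\<^esub>, l)\<close> of 2-cells induces
  the unit. Its inverse, when \<open>l\<close> has one, is induced by the inverse of \<open>l\<close>.\<close>

lemma limit_reflection:
  obtains d \<eta> where "w_reflection w A p d \<eta>" "q \<odot> d = f" "id2 L q \<star> \<eta> = l" "l \<star> id2 L d = id2 L f"
proof -
  let ?a = "src L f"
  have "w_cone w A f ?a (id1 L ?a) (id2 L f) f"
    by (simp add: w_cone_iff invertible2_id)
  then obtain d where d: "d \<in> Mor L" "src L d = ?a" "trg L d = C"
    and pd: "p \<odot> d = id1 L ?a" and qd: "q \<odot> d = f" and ld: "l \<star> id2 L d = id2 L f"
    using cone_factor by metis
  have dp: "d \<odot> p \<in> Mor L" "src L (d \<odot> p) = C" "trg L (d \<odot> p) = C"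
    "p \<odot> (d \<odot> p) = p" "q \<odot> (d \<odot> p) = f \<odot> p"
    using d by (simp_all add: comp1_left_eq[OF pd] comp1_left_eq[OF qd])
  have ldp: "l \<star> id2 L (d \<odot> p) = id2 L (f \<odot> p)"
    using rwhisk_rwhisk[of l p d] d ld by simp
  \<comment> \<open>The 2-cells \<open>id\<^bsub>p\<^esub> : p \<Rightarrow> p d p\<close> and \<open>l : q \<Rightarrow> q d p\<close> are compatible since \<open>l d p = id\<close>.\<close>
  have "\<exists>!\<phi>. \<phi> \<in> Cell L \<and> dom2 L \<phi> = id1 L C \<and> cod2 L \<phi> = d \<odot> p \<and> id2 L p \<star> \<phi> = id2 L p \<and> id2 L q \<star> \<phi> = l"
    by (rule cell_factor) (use d dp ldp in simp_all)
  then obtain \<eta> where \<eta>: "\<eta> \<in> Cell L" "dom2 L \<eta> = id1 L C" "cod2 L \<eta> = d \<odot> p"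
    "id2 L p \<star> \<eta> = id2 L p" "id2 L q \<star> \<eta> = l" by blast
  have "\<eta> \<star> id2 L d = id2 L d"
  proof (rule cell_eqI)
    have "id2 L p \<star> (\<eta> \<star> id2 L d) = (id2 L p \<star> \<eta>) \<star> id2 L d"
      "id2 L q \<star> (\<eta> \<star> id2 L d) = (id2 L q \<star> \<eta>) \<star> id2 L d"
      using d dp \<eta>(1-3) by (simp_all add: hcomp_ass)
    then show "id2 L p \<star> (\<eta> \<star> id2 L d) = id2 L p \<star> id2 L d"
      "id2 L q \<star> (\<eta> \<star> id2 L d) = id2 L q \<star> id2 L d"
      using d \<eta> ld qd by simp_all
  qed (use d dp \<eta> pd in \<open>simp_all add: comp1_ass\<close>)
  then have r: "reflection L p d \<eta>"
    using d \<eta> pd by (simp add: reflection_def)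
  have "invertible2 L \<eta>" if pseudo: "w = Pseudo"
  proof -
    obtain m where m: "m \<in> Cell L" "dom2 L m = f \<odot> p" "cod2 L m = q"
      "m \<bullet> l = id2 L q" "l \<bullet> m = id2 L (f \<odot> p)"
      by (rule invertible2D[OF cone_invertible[OF pseudo]]) auto
    have "\<exists>!\<phi>. \<phi> \<in> Cell L \<and> dom2 L \<phi> = d \<odot> p \<and> cod2 L \<phi> = id1 L C \<and> id2 L p \<star> \<phi> = id2 L p \<and> id2 L q \<star> \<phi> = m"
      by (rule cell_factor) (use d dp ldp m in simp_all)
    then obtain \<zeta> where \<zeta>: "\<zeta> \<in> Cell L" "dom2 L \<zeta> = d \<odot> p" "cod2 L \<zeta> = id1 L C"
      "id2 L p \<star> \<zeta> = id2 L p" "id2 L q \<star> \<zeta> = m" by blast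
    have 1: "\<zeta> \<bullet> \<eta> = id2 L (id1 L C)"
      by (rule cell_eqI) (use d dp \<eta> \<zeta> m in \<open>simp_all add: lwhisk_vcomp\<close>)
    have 2: "\<eta> \<bullet> \<zeta> = id2 L (d \<odot> p)"
      by (rule cell_eqI) (use d dp \<eta> \<zeta> m in \<open>simp_all add: lwhisk_vcomp\<close>)
    show ?thesis using 1 2 \<eta> \<zeta> d by (intro invertible2I[where \<beta> = \<zeta>]) simp_all
  qed
  then have "w_reflection w A p d \<eta>" using r by (simp add: w_reflection_iff)
  then show thesis using that qd \<eta>(5) ld by blast
qed

end

text \<open>The limit together with the reflection that it carries. It presents \<open>f\<close> as \<open>q d\<close>.\<close>

locale limit_presentation = loose_limit L A w f C p l q
  for L :: "('o, 'n, 'd) two_cat" (structure) and A :: "('o, 'm, 'c, 'n, 'd) F_cat"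
    and w f C p l q +
  fixes d :: 'n and \<eta> :: 'd
  assumes refl: "w_reflection w A p d \<eta>"
    and q_d: "q \<odot> d = f" and q_\<eta>: "id2 L q \<star> \<eta> = l" and l_d: "l \<star> id2 L d = id2 L f"
begin

lemma refl_L: "reflection L p d \<eta>"
  using refl by (simp add: w_reflection_iff)

lemma refl_arr [simp]:
  "d \<in> Mor L" "src L d = src L f" "trg L d = C" "\<eta> \<in> Cell L" "dom2 L \<eta> = id1 L C"
  "cod2 L \<eta> = d \<odot> p"
  using refl_L by (simp_all add: reflection_def)

lemma p_d: "p \<odot> d = id1 L (src L f)" and p_\<eta>: "id2 L p \<star> \<eta> = id2 L p"
  using refl_L by (simp_all add: reflection_def)

text \<open>The comparison is induced by the cone \<open>(t u, k \<nu>, k)\<close>, where \<open>k \<nu> : k \<Rightarrow> k v u = f t u\<close>. It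
  commutes with right adjoints and units because both sides have the same projections.\<close>

lemma comparison:
  assumes r: "w_reflection w A u v \<nu>" and t: "is_tight A t" "src L t = trg L u" "trg L t = src L f"
    and k: "is_tight A k" "src L k = src L u" "trg L k = trg L f" and kv: "k \<odot> v = f \<odot> t"
  obtains c where "refl_morphism A u v \<nu> p d \<eta> c t" "is_tight A c" "src L c = src L u" "trg L c = C" "q \<odot> c = k"
proof -
  have rL: "reflection L u v \<nu>" and u: "is_tight A u" using r by (auto simp: w_reflection_iff)
  have uv [simp]: "u \<in> Mor L" "v \<in> Mor L" "src L v = trg L u" "trg L v = src L u"
    "\<nu> \<in> Cell L" "dom2 L \<nu> = id1 L (src L u)" "cod2 L \<nu> = v \<odot> u"
    and uv1: "u \<odot> v = id1 L (trg L u)"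
    and u\<nu>: "id2 L u \<star> \<nu> = id2 L u" and \<nu>v: "\<nu> \<star> id2 L v = id2 L v"
    using rL by (auto simp: reflection_def)
  note [simp] = t k
  have kvu: "k \<odot> (v \<odot> u) = f \<odot> (t \<odot> u)"
    using comp1_left_eq[OF kv, of u] by (simp add: comp1_ass)
  have "w_cone w A f (src L u) (t \<odot> u) (id2 L k \<star> \<nu>) k"
    using r by (auto simp: w_cone_iff w_reflection_iff kvu intro!: invertible2_lwhisk)
  then obtain c where c [simp]: "c \<in> Mor L" "src L c = src L u" "trg L c = C"
    and pc: "p \<odot> c = t \<odot> u" and qc: "q \<odot> c = k" and lc: "l \<star> id2 L c = id2 L k \<star> \<nu>"
    by (rule cone_factor)
  have tight: "is_tight A c" using pc qc u by (simp add: tight_iff)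
  have cv: "c \<odot> v = d \<odot> t"
  proof (rule cone_factor_unique)
    show "p \<odot> (c \<odot> v) = p \<odot> (d \<odot> t)"
      by (simp add: comp1_left_eq[OF pc] comp1_left_eq[OF p_d] comp1_ass uv1)
    show "q \<odot> (c \<odot> v) = q \<odot> (d \<odot> t)"
      by (simp add: comp1_left_eq[OF qc] comp1_left_eq[OF q_d] kv)
    have "l \<star> id2 L (c \<odot> v) = (l \<star> id2 L c) \<star> id2 L v" by (simp add: rwhisk_rwhisk)
    also have "\<dots> = id2 L k \<star> (\<nu> \<star> id2 L v)" unfolding lc by (simp add: hcomp_ass)
    also have "\<dots> = id2 L (f \<odot> t)" by (simp add: \<nu>v kv)
    also have "\<dots> = (l \<star> id2 L d) \<star> id2 L t" by (simp add: l_d)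
    also have "\<dots> = l \<star> id2 L (d \<odot> t)" by (simp add: rwhisk_rwhisk)
    finally show "l \<star> id2 L (c \<odot> v) = l \<star> id2 L (d \<odot> t)" .
  qed simp_all
  have c\<nu>: "id2 L c \<star> \<nu> = \<eta> \<star> id2 L c"
  proof (rule cell_eqI)
    have "id2 L p \<star> (id2 L c \<star> \<nu>) = id2 L t \<star> (id2 L u \<star> \<nu>)"
      by (simp add: lwhisk_lwhisk pc)
    moreover have "id2 L p \<star> (\<eta> \<star> id2 L c) = (id2 L p \<star> \<eta>) \<star> id2 L c"
      by (simp add: hcomp_ass)
    ultimately show "id2 L p \<star> (id2 L c \<star> \<nu>) = id2 L p \<star> (\<eta> \<star> id2 L c)"
      by (simp add: u\<nu> p_\<eta> pc)
    have "id2 L q \<star> (id2 L c \<star> \<nu>) = id2 L k \<star> \<nu>" by (simp add: lwhisk_lwhisk qc)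
    moreover have "id2 L q \<star> (\<eta> \<star> id2 L c) = (id2 L q \<star> \<eta>) \<star> id2 L c"
      by (simp add: hcomp_ass)
    ultimately show "id2 L q \<star> (id2 L c \<star> \<nu>) = id2 L q \<star> (\<eta> \<star> id2 L c)"
      by (simp add: q_\<eta> lc)
    show "cod2 L (\<eta> \<star> id2 L c) = cod2 L (id2 L c \<star> \<nu>)"
      by (simp add: comp1_ass pc comp1_left_eq[OF cv])
  qed simp_all
  have "refl_morphism A u v \<nu> p d \<eta> c t"
    using rL refl_L u tight pc cv c\<nu> by (simp add: refl_morphism_iff)
  then show thesis using that tight qc by simp
qed

text \<open>A 2-cell \<open>\<alpha> : k v \<Rightarrow> f\<close> turns the presentation \<open>(u, k)\<close> of its domain into the cone
  \<open>(u, (\<alpha> u) (k \<nu>), k)\<close> over \<open>f\<close>, hence into a tight \<open>c\<close>. It is recovered from \<open>c\<close> because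
  \<open>q \<eta> c v = l c v\<close> is that cone restricted along \<open>v\<close>.\<close>

lemma lax_cell_presentation:
  assumes w: "w \<noteq> Pseudo" and r: "w_reflection w A u v \<nu>"
    and k: "is_tight A k" "src L k = src L u" "trg L k = trg L f"
    and \<alpha>: "\<alpha> \<in> Cell L" "dom2 L \<alpha> = k \<odot> v" "cod2 L \<alpha> = f"
  obtains c where "is_tight A c" "src L c = src L u" "trg L c = C" "p \<odot> c = u" "q \<odot> c = k"
    "id2 L q \<star> (\<eta> \<star> id2 L (c \<odot> v)) = \<alpha>"
proof -
  have rL: "reflection L u v \<nu>" and u: "is_tight A u" using r by (auto simp: w_reflection_iff)
  have uv [simp]: "u \<in> Mor L" "v \<in> Mor L" "src L v = trg L u" "trg L v = src L u"
    "\<nu> \<in> Cell L" "dom2 L \<nu> = id1 L (src L u)" "cod2 L \<nu> = v \<odot> u"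
    and uv1: "u \<odot> v = id1 L (trg L u)"
    and \<nu>v: "\<nu> \<star> id2 L v = id2 L v"
    using rL by (auto simp: reflection_def)
  note [simp] = k \<alpha>
  have f: "src L f = trg L u" using \<alpha> cell_arr(3)[OF \<alpha>(1)] by simp
  let ?\<kappa> = "(\<alpha> \<star> id2 L u) \<bullet> (id2 L k \<star> \<nu>)"
  have \<kappa>: "w_cone w A f (src L u) u ?\<kappa> k"
    using w by (simp add: w_cone_iff f comp1_ass)
  then obtain c where c [simp]: "c \<in> Mor L" "src L c = src L u" "trg L c = C"
    and pc: "p \<odot> c = u" and qc: "q \<odot> c = k" and lc: "l \<star> id2 L c = ?\<kappa>"
    by (rule cone_factor)
  have tight: "is_tight A c" using pc qc u by (simp add: tight_iff)
  have "id2 L q \<star> (\<eta> \<star> id2 L (c \<odot> v)) = (id2 L q \<star> \<eta>) \<star> id2 L (c \<odot> v)"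
    by (simp add: hcomp_ass)
  also have "\<dots> = ?\<kappa> \<star> id2 L v"
    by (simp add: q_\<eta> flip: rwhisk_rwhisk lc)
  also have "\<dots> = ((\<alpha> \<star> id2 L u) \<star> id2 L v) \<bullet> ((id2 L k \<star> \<nu>) \<star> id2 L v)"
    by (rule rwhisk_vcomp) (simp_all add: comp1_ass)
  also have "(\<alpha> \<star> id2 L u) \<star> id2 L v = \<alpha>"
    by (simp add: rwhisk_rwhisk uv1)
  also have "(id2 L k \<star> \<nu>) \<star> id2 L v = id2 L (k \<odot> v)"
    by (simp add: hcomp_ass \<nu>v)
  finally have "id2 L q \<star> (\<eta> \<star> id2 L (c \<odot> v)) = \<alpha>" by simp
  then show thesis using that tight pc qc by simp
qed

text \<open>In the pseudo case the cone used above is not invertible unless \<open>\<alpha>\<close> is. Instead both ends of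
  \<open>\<alpha>\<close> are presented over the limit of \<open>f = g u\<close>: with respect to the composite reflection
  \<open>u p \<stileturn> d v\<close>, the tight \<open>k p\<close> presents \<open>k v\<close> and the tight \<open>q\<close> presents \<open>g\<close>. Then \<open>\<beta> = l\<^sup>-\<^sup>1 (\<alpha> u p) (k \<nu> p)\<close> is a 2-cell between these tight
  morphisms which restricts to \<open>\<alpha>\<close> along \<open>d v\<close>.\<close>

lemma pseudo_cell_presentation:
  assumes w: "w = Pseudo" and r: "w_reflection w A u v \<nu>"
    and g: "g \<in> Mor L" "src L g = trg L u" and f_def: "f = g \<odot> u"
    and k: "is_tight A k" "src L k = src L u" "trg L k = trg L g"
    and \<alpha>: "\<alpha> \<in> Cell L" "dom2 L \<alpha> = k \<odot> v" "cod2 L \<alpha> = g"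
  obtains \<beta> where "\<beta> \<in> Cell L" "dom2 L \<beta> = k \<odot> p" "cod2 L \<beta> = q"
    "\<beta> \<star> id2 L (d \<odot> v) = \<alpha>"
proof -
  have rL: "reflection L u v \<nu>" and u: "is_tight A u" using r by (auto simp: w_reflection_iff)
  have uv [simp]: "u \<in> Mor L" "v \<in> Mor L" "src L v = trg L u" "trg L v = src L u"
    "\<nu> \<in> Cell L" "dom2 L \<nu> = id1 L (src L u)" "cod2 L \<nu> = v \<odot> u"
    and uv1: "u \<odot> v = id1 L (trg L u)" and \<nu>v: "\<nu> \<star> id2 L v = id2 L v"
    using rL by (auto simp: reflection_def)
  note [simp] = g k \<alpha>
  have sf [simp]: "src L f = src L u" "trg L f = trg L g" by (simp_all add: f_def)
  obtain m where m [simp]: "m \<in> Cell L" "dom2 L m = f \<odot> p" "cod2 L m = q"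
    and ml: "m \<bullet> l = id2 L q"
    by (rule invertible2D[OF cone_invertible[OF w]]) auto
  have gup: "g \<odot> (u \<odot> p) = f \<odot> p" by (simp add: f_def comp1_ass)
  have fv: "f \<odot> v = g" by (simp add: f_def comp1_ass uv1)
  have pdv: "p \<odot> (d \<odot> v) = v" by (simp add: comp1_left_eq[OF p_d])
  have qdv: "q \<odot> (d \<odot> v) = g" by (simp add: comp1_left_eq[OF q_d] fv)
  let ?x = "id2 L k \<star> (\<nu> \<star> id2 L p)" and ?y = "\<alpha> \<star> id2 L (u \<odot> p)"
  have x: "?x \<in> Cell L" "dom2 L ?x = k \<odot> p" "cod2 L ?x = (k \<odot> v) \<odot> (u \<odot> p)"
    by (simp_all add: comp1_ass)
  have y: "?y \<in> Cell L" "dom2 L ?y = (k \<odot> v) \<odot> (u \<odot> p)" "cod2 L ?y = f \<odot> p"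
    by (simp_all add: gup)
  have "?x \<star> id2 L (d \<odot> v) = id2 L (k \<odot> v)"
    by (simp add: hcomp_ass pdv \<nu>v)
  moreover have "?y \<star> id2 L (d \<odot> v) = \<alpha>"
    by (simp add: rwhisk_rwhisk comp1_ass pdv uv1)
  moreover have "m \<star> id2 L (d \<odot> v) = id2 L g"
  proof -
    have "l \<star> id2 L (d \<odot> v) = id2 L g"
      using rwhisk_rwhisk[of l v d] by (simp add: l_d fv)
    moreover have "(m \<bullet> l) \<star> id2 L (d \<odot> v) = (m \<star> id2 L (d \<odot> v)) \<bullet> (l \<star> id2 L (d \<odot> v))"
      by (rule rwhisk_vcomp) simp_all
    ultimately show ?thesis
      by (simp add: ml qdv pdv comp1_ass fv)
  qed
  moreover have "(m \<bullet> (?y \<bullet> ?x)) \<star> id2 L (d \<odot> v) =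
      (m \<star> id2 L (d \<odot> v)) \<bullet> ((?y \<star> id2 L (d \<odot> v)) \<bullet> (?x \<star> id2 L (d \<odot> v)))"
    using x y by (simp add: rwhisk_vcomp del: hcomp_arr)
  ultimately have "(m \<bullet> (?y \<bullet> ?x)) \<star> id2 L (d \<odot> v) = \<alpha>" by simp
  moreover have "m \<bullet> (?y \<bullet> ?x) \<in> Cell L" "dom2 L (m \<bullet> (?y \<bullet> ?x)) = k \<odot> p"
    "cod2 L (m \<bullet> (?y \<bullet> ?x)) = q"
    using x y by (simp_all del: hcomp_arr)
  ultimately show thesis using that by blast
qed

end

lemma (in F_category_locale) limit_presentation_exists:
  assumes "f \<in> Mor L" "cone_limit A (w_cone w A f) f C p l q"
  obtains d \<eta> where "limit_presentation L A w f C p l q d \<eta>"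
proof -
  interpret loose_limit L A w f C p l q
    by unfold_locales (use assms in auto)
  obtain d \<eta> where "w_reflection w A p d \<eta>" "q \<odot> d = f" "id2 L q \<star> \<eta> = l" "l \<star> id2 L d = id2 L f"
    by (rule limit_reflection)
  then have "limit_presentation L A w f C p l q d \<eta>" by unfold_locales
  then show thesis using that by blast
qed

section \<open>Extending along the inclusion of tight morphisms\<close>

text \<open>A commuting square from the inclusion of the tight morphisms of \<open>A\<close> to \<open>G\<close>, to be filled by an
  F-functor from \<open>A\<close> to \<open>D\<close>.\<close>

locale lifting_problem =
  A: F_category_locale "loose A" A + D: F_category_locale "loose D" D +
  E: F_category_locale "loose E" E +
  G: two_functor "loose D" "loose E" G + S: two_functor "loose A" "loose E" S +
  R: two_functor "tight A" "loose D" R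
  for A :: "('o, 'm, 'c, 'n, 'd) F_cat" and D :: "('o2, 'm2, 'c2, 'n2, 'd2) F_cat"
    and E :: "('o3, 'm3, 'c3, 'n3, 'd3) F_cat" and G R S +
  fixes w :: laxity
  assumes not_Colax: "w \<noteq> Colax"
    and limits: "f \<in> Mor (loose A) \<Longrightarrow> \<exists>C p l q. cone_limit A (w_cone w A f) f C p l q"
    and R_tight: "t \<in> Mor (tight A) \<Longrightarrow> is_tight D (on1 R t)"
    and S_tight: "is_tight A f \<Longrightarrow> is_tight E (on1 S f)"
    and G_Refl: "w_Refl w D E G" and G_Morph: "w_Morph w D E G"
    and G_faithful: "locally_faithful (loose D) G"
    and square: "fun_eq (tight A) (G \<circ>\<^sub>2 R) (S \<circ>\<^sub>2 incl A)"
begin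

abbreviation comp_A (infixr "\<odot>\<^sub>A" 75) where "g \<odot>\<^sub>A f \<equiv> g \<odot>\<^bsub>loose A\<^esub> f"
abbreviation comp_D (infixr "\<odot>\<^sub>D" 75) where "g \<odot>\<^sub>D f \<equiv> g \<odot>\<^bsub>loose D\<^esub> f"
abbreviation comp_E (infixr "\<odot>\<^sub>E" 75) where "g \<odot>\<^sub>E f \<equiv> g \<odot>\<^bsub>loose E\<^esub> f"

abbreviation R1 where "R1 f \<equiv> on1 R (A.as_tight f)"

lemma R0_Obj [simp]: "X \<in> Obj (loose A) \<Longrightarrow> on0 R X \<in> Obj (loose D)"
  using R.on0_Obj[of X] by (simp add: A.Obj_tight)

lemma R1_tight [simp]: "is_tight A f \<Longrightarrow> is_tight D (R1 f)"
  by (simp add: R_tight)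

lemma R1_comp: "is_tight A f \<Longrightarrow> is_tight A g \<Longrightarrow> trg (loose A) f = src (loose A) g \<Longrightarrow>
    R1 (g \<odot>\<^sub>A f) = R1 g \<odot>\<^sub>D R1 f"
  by (simp add: A.as_tight_comp R.on1_comp)

lemma R1_id: "X \<in> Obj (loose A) \<Longrightarrow> R1 (id1 (loose A) X) = id1 (loose D) (on0 R X)"
  by (simp add: A.as_tight_id R.on1_id1 A.Obj_tight)

lemma G_R0 [simp]: "X \<in> Obj (loose A) \<Longrightarrow> on0 G (on0 R X) = on0 S X"
  using square by (simp add: fun_eq_def comp_fun_def A.Obj_tight)

lemma G_R1 [simp]: "is_tight A f \<Longrightarrow> on1 G (R1 f) = on1 S f"
  using square by (simp add: fun_eq_def comp_fun_def)

lemma G_R2: "\<gamma> \<in> Cell (tight A) \<Longrightarrow> on2 G (on2 R \<gamma>) = on2 S (on2 (incl A) \<gamma>)"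
  using square by (simp add: fun_eq_def comp_fun_def)

lemma cell_eqI:
  assumes "\<kappa> \<in> Cell (loose D)" "\<kappa>' \<in> Cell (loose D)" "dom2 (loose D) \<kappa>' = dom2 (loose D) \<kappa>"
    "cod2 (loose D) \<kappa>' = cod2 (loose D) \<kappa>" "on2 G \<kappa> = on2 G \<kappa>'"
  shows "\<kappa> = \<kappa>'"
  using G_faithful assms unfolding locally_faithful_def hom2_def by blast

lemma S_w_reflection:
  assumes "w_reflection w A u v \<nu>"
  shows "w_reflection w E (on1 S u) (on1 S v) (on2 S \<nu>)"
  using assms S_tight S.on_reflection S.on2_invertible
  by (simp add: A.w_reflection_iff E.w_reflection_iff)

text \<open>The reflection \<open>(1, R u \<stileturn> v', \<nu>')\<close> in \<open>D\<close> lies over the image under \<open>S\<close> of \<open>(1, u \<stileturn> v, \<nu>)\<close>.\<close>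

definition lifts where
  "lifts u v \<nu> v' \<nu>' \<longleftrightarrow> w_reflection w A u v \<nu> \<and> w_reflection w D (R1 u) v' \<nu>' \<and>
     on1 G v' = on1 S v \<and> on2 G \<nu>' = on2 S \<nu>"

lemma lifts_ex1:
  assumes "w_reflection w A u v \<nu>"
  shows "\<exists>!(v', \<nu>'). w_reflection w D (R1 u) v' \<nu>' \<and> on1 G v' = on1 S v \<and> on2 G \<nu>' = on2 S \<nu>"
proof (rule w_Refl_lift[OF not_Colax G_Refl])
  have "is_tight A u" using assms by (simp add: A.w_reflection_iff)
  then show "is_tight D (R1 u)" "w_reflection w E (on1 G (R1 u)) (on1 S v) (on2 S \<nu>)"
    using S_w_reflection[OF assms] by simp_all
qed

lemma lifts_exist:
  assumes "w_reflection w A u v \<nu>"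
  obtains v' \<nu>' where "lifts u v \<nu> v' \<nu>'"
  using lifts_ex1[OF assms] assms that by (auto simp: lifts_def)

lemma lifts_unique:
  assumes "lifts u v \<nu> v1 \<nu>1" "lifts u v \<nu> v2 \<nu>2"
  shows "v1 = v2"
proof -
  have "w_reflection w A u v \<nu>" using assms by (simp add: lifts_def)
  from lifts_ex1[OF this] show ?thesis using assms by (auto simp: lifts_def)
qed

lemma liftsD:
  assumes "lifts u v \<nu> v' \<nu>'"
  shows "is_tight A u" "reflection (loose A) u v \<nu>" "reflection (loose D) (R1 u) v' \<nu>'"
    "on1 G v' = on1 S v" "on2 G \<nu>' = on2 S \<nu>"
  using assms by (auto simp: lifts_def A.w_reflection_iff D.w_reflection_iff)

lemma lifts_arr:
  assumes "lifts u v \<nu> v' \<nu>'"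
  shows "v \<in> Mor (loose A)" "src (loose A) v = trg (loose A) u" "trg (loose A) v = src (loose A) u"
    "v' \<in> Mor (loose D)" "src (loose D) v' = on0 R (trg (loose A) u)"
    "trg (loose D) v' = on0 R (src (loose A) u)"
  using liftsD[OF assms] by (simp_all add: reflection_def)

lemma lifts_id:
  assumes "X \<in> Obj (loose A)"
  shows "lifts (id1 (loose A) X) (id1 (loose A) X) (id2 (loose A) (id1 (loose A) X))
    (id1 (loose D) (on0 R X)) (id2 (loose D) (id1 (loose D) (on0 R X)))"
  unfolding lifts_def
  using assms A.w_reflection_id[of X w] D.w_reflection_id[of "on0 R X" w]
  by (simp add: R1_id G.on1_id1 S.on1_id1 G.on2_id2 S.on2_id2)

lemma lifts_comp:
  assumes 1: "lifts u1 v1 \<nu>1 v1' \<nu>1'" and 2: "lifts u2 v2 \<nu>2 v2' \<nu>2'"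
    and c: "trg (loose A) u1 = src (loose A) u2"
  obtains \<nu> \<nu>' where "lifts (u2 \<odot>\<^sub>A u1) (v1 \<odot>\<^sub>A v2) \<nu> (v1' \<odot>\<^sub>D v2') \<nu>'"
proof -
  let ?\<nu> = "rwhisk (loose A) (lwhisk (loose A) v1 \<nu>2) u1 \<bullet>\<^bsub>loose A\<^esub> \<nu>1"
  let ?\<nu>' = "rwhisk (loose D) (lwhisk (loose D) v1' \<nu>2') (R1 u1) \<bullet>\<^bsub>loose D\<^esub> \<nu>1'"
  note d1 = liftsD[OF 1] and d2 = liftsD[OF 2]
  have A: "w_reflection w A (u2 \<odot>\<^sub>A u1) (v1 \<odot>\<^sub>A v2) ?\<nu>"
    using 1 2 c by (intro A.w_reflection_comp) (simp_all add: lifts_def)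
  have "w_reflection w D (R1 u2 \<odot>\<^sub>D R1 u1) (v1' \<odot>\<^sub>D v2') ?\<nu>'"
    using 1 2 c d1(1) d2(1) by (intro D.w_reflection_comp) (simp_all add: lifts_def)
  then have D: "w_reflection w D (R1 (u2 \<odot>\<^sub>A u1)) (v1' \<odot>\<^sub>D v2') ?\<nu>'"
    using c d1(1) d2(1) by (simp add: R1_comp)
  have "on1 G (v1' \<odot>\<^sub>D v2') = on1 S (v1 \<odot>\<^sub>A v2)"
    using c lifts_arr[OF 1] lifts_arr[OF 2] d1(4) d2(4)
    by (simp add: G.on1_comp S.on1_comp)
  moreover have "on2 G ?\<nu>' = on2 S ?\<nu>"
    using c d1 d2 lifts_arr[OF 1] lifts_arr[OF 2]
    by (simp add: reflection_def G.on2_vcomp_arr S.on2_vcomp_arr G.on2_hcomp_arr S.on2_hcomp_arr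
        G.on2_id2 S.on2_id2 A.comp1_ass D.comp1_ass)
  ultimately show thesis using that A D by (simp add: lifts_def)
qed

text \<open>The image under \<open>S\<close> of a morphism of reflections is the image under \<open>G\<close> of the square
  \<open>(R c, R t)\<close> between the lifts; by w-Morph this square is itself a morphism of reflections.\<close>

lemma lifts_morphism:
  assumes 1: "lifts u1 v1 \<nu>1 v1' \<nu>1'" and 2: "lifts u2 v2 \<nu>2 v2' \<nu>2'"
    and m: "refl_morphism A u1 v1 \<nu>1 u2 v2 \<nu>2 c t"
  shows "v2' \<odot>\<^sub>D R1 t = R1 c \<odot>\<^sub>D v1'"
proof -
  note d1 = liftsD[OF 1] and d2 = liftsD[OF 2]
  have m': "is_tight A c" "is_tight A t"
    "src (loose A) c = src (loose A) u1" "trg (loose A) c = src (loose A) u2"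
    "src (loose A) t = trg (loose A) u1" "trg (loose A) t = trg (loose A) u2"
    "u2 \<odot>\<^sub>A c = t \<odot>\<^sub>A u1" "v2 \<odot>\<^sub>A t = c \<odot>\<^sub>A v1"
    "lwhisk (loose A) c \<nu>1 = rwhisk (loose A) \<nu>2 c"
    using m A.refl_morphism_iff[OF d1(2) d2(2)] by blast+
  have "R1 u2 \<odot>\<^sub>D R1 c = R1 t \<odot>\<^sub>D R1 u1"
    using R1_comp[of c u2] R1_comp[of u1 t] m'(1-7) d1(1) d2(1) by simp
  then have sq: "tight_square D (R1 u1) (R1 u2) (R1 c) (R1 t)"
    using m'(1-6) d1(1) d2(1) by (simp add: tight_square_def hom1_def)
  have S1: "reflection (loose E) (on1 S u1) (on1 S v1) (on2 S \<nu>1)"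
    "reflection (loose E) (on1 S u2) (on1 S v2) (on2 S \<nu>2)"
    using S.on_reflection d1(2) d2(2) by blast+
  have comps: "on1 S u2 \<odot>\<^sub>E on1 S c = on1 S t \<odot>\<^sub>E on1 S u1"
    "on1 S v2 \<odot>\<^sub>E on1 S t = on1 S c \<odot>\<^sub>E on1 S v1"
    using S.on1_comp[of c u2] S.on1_comp[of u1 t] S.on1_comp[of t v2] S.on1_comp[of v1 c]
      m'(1-8) d1(1) d2(1) lifts_arr[OF 1] lifts_arr[OF 2] by simp_all
  have "lwhisk (loose E) (on1 S c) (on2 S \<nu>1) = on2 S (lwhisk (loose A) c \<nu>1)"
    using m'(1-8) d1(1,2) by (simp add: reflection_def S.on2_hcomp_arr S.on2_id2)
  also have "\<dots> = rwhisk (loose E) (on2 S \<nu>2) (on1 S c)"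
    using m'(1-6,9) d2(1,2) by (simp add: reflection_def S.on2_hcomp_arr S.on2_id2)
  finally have "refl_morphism E (on1 S u1) (on1 S v1) (on2 S \<nu>1) (on1 S u2) (on1 S v2) (on2 S \<nu>2)
      (on1 S c) (on1 S t)"
    unfolding E.refl_morphism_iff[OF S1]
    using m'(1-6) d1(1) d2(1) comps S_tight by simp
  then have "refl_morphism D (R1 u1) v1' \<nu>1' (R1 u2) v2' \<nu>2' (R1 c) (R1 t)"
    using w_Morph_iff[OF not_Colax G_Morph _ _ sq, of v1' \<nu>1' v2' \<nu>2'] 1 2
    unfolding lifts_def by (simp add: d1(1) d2(1) m'(1,2))
  then show ?thesis by (simp add: refl_morphism_def)
qed

subsection \<open>Action on loose morphisms\<close>

text \<open>A limit of \<open>f\<close> is determined only up to isomorphism, so the value at \<open>f\<close> is first a relation;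
  that any two choices give the same morphism is part of \<open>K1_presentation\<close> (take \<open>t = 1\<close>).\<close>

definition is_value where
  "is_value f k \<longleftrightarrow> (\<exists>C p l q d \<eta> d' \<eta>'. limit_presentation (loose A) A w f C p l q d \<eta> \<and>
     lifts p d \<eta> d' \<eta>' \<and> k = R1 q \<odot>\<^sub>D d')"

definition K1 where
  "K1 f = (SOME k. is_value f k)"

lemma presentation_exists:
  assumes "f \<in> Mor (loose A)"
  obtains C p l q d \<eta> where "limit_presentation (loose A) A w f C p l q d \<eta>"
proof -
  obtain C p l q where l: "cone_limit A (w_cone w A f) f C p l q" using limits[OF assms] by blast
  obtain d \<eta> where "limit_presentation (loose A) A w f C p l q d \<eta>"
    by (rule A.limit_presentation_exists[OF assms l])
  then show thesis by (rule that)
qed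

lemma K1_is_value:
  assumes "f \<in> Mor (loose A)"
  shows "is_value f (K1 f)"
proof -
  obtain C p l q d \<eta> where P: "limit_presentation (loose A) A w f C p l q d \<eta>"
    using presentation_exists[OF assms] .
  obtain d' \<eta>' where "lifts p d \<eta> d' \<eta>'"
    using lifts_exist[OF limit_presentation.refl[OF P]] .
  then have "is_value f (R1 q \<odot>\<^sub>D d')" unfolding is_value_def using P by blast
  then show ?thesis unfolding K1_def by (rule someI)
qed

text \<open>The comparison \<open>c\<close> with the limit chosen for \<open>f\<close> is a morphism of reflections, so
  \<open>d' (R t) = (R c) v'\<close>, and composing with \<open>R q\<close> gives the claim since \<open>q c = k\<close>. Thus \<open>K1 f\<close> can be
  computed from any presentation of \<open>f t\<close> as a tight morphism after a right adjoint.\<close>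

lemma K1_presentation:
  assumes f: "f \<in> Mor (loose A)" and lift: "lifts u v \<nu> v' \<nu>'"
    and t: "is_tight A t" "src (loose A) t = trg (loose A) u" "trg (loose A) t = src (loose A) f"
    and k: "is_tight A k" "src (loose A) k = src (loose A) u" "trg (loose A) k = trg (loose A) f"
    and eq: "k \<odot>\<^sub>A v = f \<odot>\<^sub>A t"
  shows "K1 f \<odot>\<^sub>D R1 t = R1 k \<odot>\<^sub>D v'"
proof -
  obtain C p l q d \<eta> d' \<eta>' where P: "limit_presentation (loose A) A w f C p l q d \<eta>"
    and L: "lifts p d \<eta> d' \<eta>'" and K: "K1 f = R1 q \<odot>\<^sub>D d'"
    using K1_is_value[OF f] unfolding is_value_def by blast
  interpret P: limit_presentation "loose A" A w f C p l q d \<eta> by (rule P)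
  have r: "w_reflection w A u v \<nu>" using lift by (simp add: lifts_def)
  obtain c where m: "refl_morphism A u v \<nu> p d \<eta> c t" and c: "is_tight A c"
      "src (loose A) c = src (loose A) u" "trg (loose A) c = C" and qc: "q \<odot>\<^sub>A c = k"
    using P.comparison[OF r t k eq] .
  have "K1 f \<odot>\<^sub>D R1 t = R1 q \<odot>\<^sub>D (d' \<odot>\<^sub>D R1 t)"
    unfolding K by (rule D.comp1_ass) (use lifts_arr[OF L] t in simp_all)
  also have "\<dots> = R1 q \<odot>\<^sub>D (R1 c \<odot>\<^sub>D v')"
    by (simp add: lifts_morphism[OF lift L m])
  also have "\<dots> = (R1 q \<odot>\<^sub>D R1 c) \<odot>\<^sub>D v'"
    by (rule D.comp1_ass[symmetric]) (use lifts_arr[OF lift] liftsD(1)[OF lift] c in simp_all)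
  also have "R1 q \<odot>\<^sub>D R1 c = R1 k"
    using R1_comp[of c q] c qc by simp
  finally show ?thesis .
qed

lemma K1_arr [simp]:
  assumes "f \<in> Mor (loose A)"
  shows "K1 f \<in> Mor (loose D)" "src (loose D) (K1 f) = on0 R (src (loose A) f)"
    "trg (loose D) (K1 f) = on0 R (trg (loose A) f)" "on1 G (K1 f) = on1 S f"
proof -
  obtain C p l q d \<eta> d' \<eta>' where P: "limit_presentation (loose A) A w f C p l q d \<eta>"
    and L: "lifts p d \<eta> d' \<eta>'" and K: "K1 f = R1 q \<odot>\<^sub>D d'"
    using K1_is_value[OF assms] unfolding is_value_def by blast
  interpret P: limit_presentation "loose A" A w f C p l q d \<eta> by (rule P)
  show "K1 f \<in> Mor (loose D)" "src (loose D) (K1 f) = on0 R (src (loose A) f)"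
    "trg (loose D) (K1 f) = on0 R (trg (loose A) f)"
    unfolding K using lifts_arr[OF L] by simp_all
  have "on1 G (K1 f) = on1 S q \<odot>\<^sub>E on1 S d"
    unfolding K using lifts_arr[OF L] liftsD(4)[OF L] by (simp add: G.on1_comp)
  also have "\<dots> = on1 S (q \<odot>\<^sub>A d)"
    by (simp add: S.on1_comp)
  finally show "on1 G (K1 f) = on1 S f"
    by (simp add: P.q_d)
qed

lemma K1_presented:
  assumes "lifts u v \<nu> v' \<nu>'" and "is_tight A k" "src (loose A) k = src (loose A) u"
  shows "K1 (k \<odot>\<^sub>A v) = R1 k \<odot>\<^sub>D v'"
proof -
  have u: "is_tight A u" using liftsD[OF assms(1)] by simp
  have "K1 (k \<odot>\<^sub>A v) \<odot>\<^sub>D R1 (id1 (loose A) (trg (loose A) u)) = R1 k \<odot>\<^sub>D v'"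
    by (rule K1_presentation[OF _ assms(1)]) (use u assms lifts_arr[OF assms(1)] in simp_all)
  then show ?thesis
    using u assms lifts_arr[OF assms(1)] by (simp add: R1_id)
qed

text \<open>A tight morphism is presented by the identity reflection.\<close>

lemma K1_of_tight:
  assumes "is_tight A f"
  shows "K1 f = R1 f"
  using K1_presented[OF lifts_id assms, of "src (loose A) f"] assms by simp

text \<open>Write \<open>f = q d\<close> and \<open>g q = q1 d1\<close> using the limits of \<open>f\<close> and of \<open>g q\<close>. Then \<open>g f = q1 d1 d\<close> is
  presented by a composite reflection, which gives the value \<open>(R q1) d1' d'\<close>; and \<open>q1 d1 = g q\<close> with
  \<open>q\<close> tight gives \<open>(R q1) d1' = (K g) (R q)\<close>.\<close>

lemma K1_comp:
  assumes f: "f \<in> Mor (loose A)" and g: "g \<in> Mor (loose A)" and c: "trg (loose A) f = src (loose A) g"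
  shows "K1 (g \<odot>\<^sub>A f) = K1 g \<odot>\<^sub>D K1 f"
proof -
  obtain C p l q d \<eta> d' \<eta>' where P: "limit_presentation (loose A) A w f C p l q d \<eta>"
    and L: "lifts p d \<eta> d' \<eta>'" and K: "K1 f = R1 q \<odot>\<^sub>D d'"
    using K1_is_value[OF f] unfolding is_value_def by blast
  interpret P: limit_presentation "loose A" A w f C p l q d \<eta> by (rule P)
  have h: "g \<odot>\<^sub>A q \<in> Mor (loose A)" using g c by simp
  obtain C1 p1 l1 q1 d1 \<eta>1 where P1: "limit_presentation (loose A) A w (g \<odot>\<^sub>A q) C1 p1 l1 q1 d1 \<eta>1"
    using presentation_exists[OF h] .
  interpret P1: limit_presentation "loose A" A w "g \<odot>\<^sub>A q" C1 p1 l1 q1 d1 \<eta>1 by (rule P1)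
  obtain d1' \<eta>1' where L1: "lifts p1 d1 \<eta>1 d1' \<eta>1'"
    using lifts_exist[OF P1.refl] .
  obtain \<nu> \<nu>' where L2: "lifts (p \<odot>\<^sub>A p1) (d1 \<odot>\<^sub>A d) \<nu> (d1' \<odot>\<^sub>D d') \<nu>'"
    by (rule lifts_comp[OF L1 L]) (use g c in simp)
  have d1: "trg (loose A) d1 = src (loose A) q1" "src (loose A) d1 = C"
    using g c by simp_all
  have "q1 \<odot>\<^sub>A (d1 \<odot>\<^sub>A d) = (g \<odot>\<^sub>A q) \<odot>\<^sub>A d"
    using d1 by (intro A.comp1_left_eq[OF P1.q_d]) simp_all
  also have "\<dots> = g \<odot>\<^sub>A f"
    using g c P.q_d by (simp add: A.comp1_ass)
  finally have "K1 (g \<odot>\<^sub>A f) = R1 q1 \<odot>\<^sub>D (d1' \<odot>\<^sub>D d')"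
    using K1_presented[OF L2, of q1] g c by simp
  also have "\<dots> = (R1 q1 \<odot>\<^sub>D d1') \<odot>\<^sub>D d'"
    using lifts_arr[OF L] lifts_arr[OF L1] g c by (simp add: D.comp1_ass)
  also have "R1 q1 \<odot>\<^sub>D d1' = K1 g \<odot>\<^sub>D R1 q"
    by (rule K1_presentation[OF g L1, symmetric]) (use g c P1.q_d in simp_all)
  also have "(K1 g \<odot>\<^sub>D R1 q) \<odot>\<^sub>D d' = K1 g \<odot>\<^sub>D K1 f"
    unfolding K using lifts_arr[OF L] g c by (simp add: D.comp1_ass)
  finally show ?thesis .
qed

subsection \<open>Action on 2-cells\<close>

text \<open>Each of the two presentations of 2-cells consists of tight morphisms and 2-cells, right
  adjoints and units of reflections; replacing these by their images under \<open>R\<close> and their lifts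
  gives a 2-cell of \<open>D\<close> over \<open>S \<alpha>\<close>.\<close>

lemma K2_exists:
  assumes \<alpha>: "\<alpha> \<in> Cell (loose A)"
  shows "\<exists>\<kappa>. \<kappa> \<in> Cell (loose D) \<and> dom2 (loose D) \<kappa> = K1 (dom2 (loose A) \<alpha>) \<and>
    cod2 (loose D) \<kappa> = K1 (cod2 (loose A) \<alpha>) \<and> on2 G \<kappa> = on2 S \<alpha>"
proof -
  define f g where "f = dom2 (loose A) \<alpha>" and "g = cod2 (loose A) \<alpha>"
  have f: "f \<in> Mor (loose A)" and g: "g \<in> Mor (loose A)"
    and fg: "src (loose A) f = src (loose A) g" "trg (loose A) f = trg (loose A) g"
    using \<alpha> by (simp_all add: f_def g_def)
  obtain C p l q d \<eta> d' \<eta>' where P: "limit_presentation (loose A) A w f C p l q d \<eta>"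
    and L: "lifts p d \<eta> d' \<eta>'" and K: "K1 f = R1 q \<odot>\<^sub>D d'"
    using K1_is_value[OF f] unfolding is_value_def by blast
  interpret P: limit_presentation "loose A" A w f C p l q d \<eta> by (rule P)
  have qd: "dom2 (loose A) \<alpha> = q \<odot>\<^sub>A d" by (simp add: P.q_d f_def)
  have d': "d' \<in> Mor (loose D)" "src (loose D) d' = on0 R (src (loose A) f)"
    "trg (loose D) d' = on0 R C" "on1 G d' = on1 S d"
    using lifts_arr[OF L] liftsD[OF L] by simp_all
  have "\<exists>\<kappa>. \<kappa> \<in> Cell (loose D) \<and> dom2 (loose D) \<kappa> = K1 f \<and> cod2 (loose D) \<kappa> = K1 g \<and>
      on2 G \<kappa> = on2 S \<alpha>"
  proof (cases "w = Pseudo")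
    case False
    obtain C1 p1 l1 q1 d1 \<eta>1 d1' \<eta>1' where P1: "limit_presentation (loose A) A w g C1 p1 l1 q1 d1 \<eta>1"
      and L1: "lifts p1 d1 \<eta>1 d1' \<eta>1'" and K1: "K1 g = R1 q1 \<odot>\<^sub>D d1'"
      using K1_is_value[OF g] unfolding is_value_def by blast
    interpret P1: limit_presentation "loose A" A w g C1 p1 l1 q1 d1 \<eta>1 by (rule P1)
    have k: "src (loose A) q = src (loose A) p" "trg (loose A) q = trg (loose A) g"
      using fg by simp_all
    obtain c where c: "is_tight A c" "src (loose A) c = src (loose A) p" "trg (loose A) c = C1"
      "p1 \<odot>\<^sub>A c = p" "q1 \<odot>\<^sub>A c = q"
      and c\<alpha>: "id2 (loose A) q1 \<star>\<^bsub>loose A\<^esub> (\<eta>1 \<star>\<^bsub>loose A\<^esub> id2 (loose A) (c \<odot>\<^sub>A d)) = \<alpha>"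
      using P1.lax_cell_presentation[OF False P.refl P.cone_arr(2) k \<alpha> qd g_def[symmetric]] .
    have Rc: "R1 p1 \<odot>\<^sub>D R1 c = R1 p" "R1 q1 \<odot>\<^sub>D R1 c = R1 q"
      using R1_comp[of c p1] R1_comp[of c q1] c by simp_all
    have Pd: "R1 p \<odot>\<^sub>D d' = id1 (loose D) (on0 R (src (loose A) f))"
      using liftsD(3)[OF L] by (simp add: reflection_def)
    have d1': "d1' \<in> Mor (loose D)" "src (loose D) d1' = on0 R (src (loose A) g)"
      "trg (loose D) d1' = on0 R C1" "on1 G d1' = on1 S d1"
      using lifts_arr[OF L1] liftsD[OF L1] by simp_all
    have \<eta>1': "\<eta>1' \<in> Cell (loose D)" "dom2 (loose D) \<eta>1' = id1 (loose D) (on0 R C1)"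
      "cod2 (loose D) \<eta>1' = d1' \<odot>\<^sub>D R1 p1" "on2 G \<eta>1' = on2 S \<eta>1"
      using liftsD(3,5)[OF L1] by (simp_all add: reflection_def)
    let ?\<kappa> = "id2 (loose D) (R1 q1) \<star>\<^bsub>loose D\<^esub> (\<eta>1' \<star>\<^bsub>loose D\<^esub> id2 (loose D) (R1 c \<odot>\<^sub>D d'))"
    have "?\<kappa> \<in> Cell (loose D)" using c d' d1' \<eta>1' by simp
    moreover have "dom2 (loose D) ?\<kappa> = K1 f"
    proof -
      have "dom2 (loose D) ?\<kappa> = R1 q1 \<odot>\<^sub>D (R1 c \<odot>\<^sub>D d')" using c d' d1' \<eta>1' by simp
      also have "\<dots> = R1 q \<odot>\<^sub>D d'"
        by (rule D.comp1_left_eq[OF Rc(2)]) (use c d' in simp_all)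
      finally show ?thesis by (simp add: K)
    qed
    moreover have "cod2 (loose D) ?\<kappa> = K1 g"
    proof -
      have 1: "R1 p1 \<odot>\<^sub>D (R1 c \<odot>\<^sub>D d') = id1 (loose D) (on0 R (src (loose A) f))"
        by (subst D.comp1_left_eq[OF Rc(1)]) (use c d' Pd in simp_all)
      have "cod2 (loose D) ?\<kappa> = R1 q1 \<odot>\<^sub>D (d1' \<odot>\<^sub>D (R1 p1 \<odot>\<^sub>D (R1 c \<odot>\<^sub>D d')))"
        using c d' d1' \<eta>1' by (simp add: D.comp1_ass)
      then show ?thesis using d1' fg by (simp add: 1 K1)
    qed
    moreover have "on2 G ?\<kappa> = on2 S (id2 (loose A) q1 \<star>\<^bsub>loose A\<^esub> (\<eta>1 \<star>\<^bsub>loose A\<^esub> id2 (loose A) (c \<odot>\<^sub>A d)))"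
      using c(1-3) d' d1' \<eta>1'
      by (simp add: G.on2_hcomp_arr S.on2_hcomp_arr G.on2_id2 S.on2_id2 G.on1_comp S.on1_comp)
    ultimately show ?thesis using c\<alpha> by metis
  next
    case True
    have h: "g \<odot>\<^sub>A p \<in> Mor (loose A)" using g fg by simp
    obtain C1 p1 l1 q1 d1 \<eta>1 where P1: "limit_presentation (loose A) A w (g \<odot>\<^sub>A p) C1 p1 l1 q1 d1 \<eta>1"
      using presentation_exists[OF h] .
    interpret P1: limit_presentation "loose A" A w "g \<odot>\<^sub>A p" C1 p1 l1 q1 d1 \<eta>1 by (rule P1)
    have c: "trg (loose A) p1 = C" "src (loose A) d1 = C" "trg (loose A) d1 = C1"
      "trg (loose A) q1 = trg (loose A) f" "src (loose A) p = C"
      using g fg by simp_all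
    obtain d1' \<eta>1' where L1: "lifts p1 d1 \<eta>1 d1' \<eta>1'"
      using lifts_exist[OF P1.refl] .
    obtain \<nu> \<nu>' where L2: "lifts (p \<odot>\<^sub>A p1) (d1 \<odot>\<^sub>A d) \<nu> (d1' \<odot>\<^sub>D d') \<nu>'"
      by (rule lifts_comp[OF L1 L]) (use c in simp)
    have k: "src (loose A) g = trg (loose A) p" "src (loose A) q = src (loose A) p"
      "trg (loose A) q = trg (loose A) g"
      using fg by simp_all
    obtain \<beta> where \<beta>: "\<beta> \<in> Cell (loose A)" "dom2 (loose A) \<beta> = q \<odot>\<^sub>A p1" "cod2 (loose A) \<beta> = q1"
      and \<beta>\<alpha>: "\<beta> \<star>\<^bsub>loose A\<^esub> id2 (loose A) (d1 \<odot>\<^sub>A d) = \<alpha>"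
      using P1.pseudo_cell_presentation[OF True P.refl g k(1) refl P.cone_arr(2) k(2,3) \<alpha> qd
          g_def[symmetric]] .
    have qp: "is_tight A (q \<odot>\<^sub>A p1)" using c by simp
    obtain \<gamma> where \<gamma>: "\<gamma> \<in> Cell (tight A)" "on2 (incl A) \<gamma> = \<beta>"
      "dom2 (tight A) \<gamma> = A.as_tight (q \<odot>\<^sub>A p1)" "cod2 (tight A) \<gamma> = A.as_tight q1"
      using A.tight_cell[OF \<beta>(1)] \<beta>(2,3) qp by auto
    have D: "d1' \<odot>\<^sub>D d' \<in> Mor (loose D)" "trg (loose D) (d1' \<odot>\<^sub>D d') = on0 R C1"
      "on1 G (d1' \<odot>\<^sub>D d') = on1 S (d1 \<odot>\<^sub>A d)"
      using lifts_arr[OF L2] liftsD(4)[OF L2] c by simp_all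
    let ?\<kappa> = "on2 R \<gamma> \<star>\<^bsub>loose D\<^esub> id2 (loose D) (d1' \<odot>\<^sub>D d')"
    have pd: "p1 \<odot>\<^sub>A (d1 \<odot>\<^sub>A d) = d"
      by (subst A.comp1_left_eq[OF P1.p_d]) (use c in simp_all)
    have f_eq: "(q \<odot>\<^sub>A p1) \<odot>\<^sub>A (d1 \<odot>\<^sub>A d) = f"
      using c by (simp add: A.comp1_ass pd P.q_d)
    have g_eq: "q1 \<odot>\<^sub>A (d1 \<odot>\<^sub>A d) = g"
    proof -
      have "q1 \<odot>\<^sub>A (d1 \<odot>\<^sub>A d) = (g \<odot>\<^sub>A p) \<odot>\<^sub>A d"
        by (rule A.comp1_left_eq[OF P1.q_d]) (use c in simp_all)
      then show ?thesis using g fg by (simp add: A.comp1_ass P.p_d)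
    qed
    have sq: "src (loose A) (q \<odot>\<^sub>A p1) = C1" using c by simp
    have "K1 f = R1 (q \<odot>\<^sub>A p1) \<odot>\<^sub>D (d1' \<odot>\<^sub>D d')"
      using K1_presented[OF L2 qp] c by (simp add: f_eq)
    moreover have "K1 g = R1 q1 \<odot>\<^sub>D (d1' \<odot>\<^sub>D d')"
      using K1_presented[OF L2, of q1] c by (simp add: g_eq)
    moreover have "on2 G ?\<kappa> = on2 S (\<beta> \<star>\<^bsub>loose A\<^esub> id2 (loose A) (d1 \<odot>\<^sub>A d))"
      using \<gamma> \<beta> D c qp sq
      by (simp add: G.on2_hcomp_arr S.on2_hcomp_arr G.on2_id2 S.on2_id2 G_R2)
    ultimately show ?thesis
      using \<gamma> D qp sq \<beta>\<alpha> by (intro exI[of _ ?\<kappa>]) simp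
  qed
  then show ?thesis by (simp add: f_def g_def)
qed

definition K2 where
  "K2 \<alpha> = (SOME \<kappa>. \<kappa> \<in> Cell (loose D) \<and> dom2 (loose D) \<kappa> = K1 (dom2 (loose A) \<alpha>) \<and>
    cod2 (loose D) \<kappa> = K1 (cod2 (loose A) \<alpha>) \<and> on2 G \<kappa> = on2 S \<alpha>)"

lemma K2_arr [simp]:
  assumes "\<alpha> \<in> Cell (loose A)"
  shows "K2 \<alpha> \<in> Cell (loose D)" "dom2 (loose D) (K2 \<alpha>) = K1 (dom2 (loose A) \<alpha>)"
    "cod2 (loose D) (K2 \<alpha>) = K1 (cod2 (loose A) \<alpha>)" "on2 G (K2 \<alpha>) = on2 S \<alpha>"
  using someI_ex[OF K2_exists[OF assms]] unfolding K2_def by auto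

subsection \<open>The diagonal filler\<close>

definition filler where
  "filler = \<lparr>on0 = on0 R, on1 = K1, on2 = K2\<rparr>"

lemma filler_simps [simp]: "on0 filler = on0 R" "on1 filler = K1" "on2 filler = K2"
  by (simp_all add: filler_def)

text \<open>Every identity between 2-cells required of a 2-functor holds after applying \<open>G\<close>, because
  \<open>S\<close> is a 2-functor, and \<open>G\<close> is locally faithful.\<close>

lemma filler_two_functor: "two_functor (loose A) (loose D) filler"
proof (unfold_locales, goal_cases)
  case (1 X)
  then show ?case by simp
next
  case (2 f X Y)
  then show ?case by (auto simp: hom1_def)
next
  case (3 X)
  then show ?case by (simp add: K1_of_tight R1_id)
next
  case (4 f X Y g Z)
  then show ?case by (auto simp: hom1_def K1_comp)
next
  case (5 \<alpha> f g)
  then show ?case by (auto simp: hom2_def)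
next
  case (6 f)
  then have "K2 (id2 (loose A) f) = id2 (loose D) (K1 f)"
    by (intro cell_eqI) (simp_all add: S.on2_id2 G.on2_id2)
  then show ?case by simp
next
  case (7 \<alpha> f g \<beta> h)
  then have "\<alpha> \<in> Cell (loose A)" "\<beta> \<in> Cell (loose A)" "cod2 (loose A) \<alpha> = dom2 (loose A) \<beta>"
    by (auto simp: hom2_def)
  then have "K2 (\<beta> \<bullet>\<^bsub>loose A\<^esub> \<alpha>) = K2 \<beta> \<bullet>\<^bsub>loose D\<^esub> K2 \<alpha>"
    by (intro cell_eqI) (simp_all add: S.on2_vcomp_arr G.on2_vcomp_arr)
  then show ?case by simp
next
  case (8 \<alpha> f f' \<beta> g g')
  then have "\<alpha> \<in> Cell (loose A)" "\<beta> \<in> Cell (loose A)"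
    "trg (loose A) (dom2 (loose A) \<alpha>) = src (loose A) (dom2 (loose A) \<beta>)"
    by (auto simp: hom2_def)
  then have "K2 (\<beta> \<star>\<^bsub>loose A\<^esub> \<alpha>) = K2 \<beta> \<star>\<^bsub>loose D\<^esub> K2 \<alpha>"
    by (intro cell_eqI) (simp_all add: S.on2_hcomp_arr G.on2_hcomp_arr K1_comp)
  then show ?case by simp
qed

lemma filler_F_functor: "F_functor A D filler"
  using filler_two_functor A.F_category D.F_category by (simp add: F_functor_def K1_of_tight)

lemma filler_extends: "fun_eq (tight A) (filler \<circ>\<^sub>2 incl A) R"
proof -
  have "K2 (on2 (incl A) \<gamma>) = on2 R \<gamma>" if "\<gamma> \<in> Cell (tight A)" for \<gamma>
    using that by (intro cell_eqI) (simp_all add: K1_of_tight G_R2)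
  then show ?thesis
    by (simp add: fun_eq_def comp_fun_def A.Obj_tight K1_of_tight)
qed

lemma filler_lifts: "fun_eq (loose A) (G \<circ>\<^sub>2 filler) S"
  by (simp add: fun_eq_def comp_fun_def)

text \<open>Any filler preserves reflections, hence sends \<open>d\<close> to the unique lift of \<open>S d\<close>, which forces
  its value on \<open>f = q d\<close>.\<close>

lemma filler_unique:
  assumes K': "F_functor A D K'" and ext: "fun_eq (tight A) (K' \<circ>\<^sub>2 incl A) R"
    and lift: "fun_eq (loose A) (G \<circ>\<^sub>2 K') S"
  shows "fun_eq (loose A) K' filler"
proof -
  interpret K': two_functor "loose A" "loose D" K' using K' by (simp add: F_functor_def)
  have K'_tight: "is_tight A t \<Longrightarrow> is_tight D (on1 K' t)" for t
    using K' by (simp add: F_functor_def)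
  have K'0: "on0 K' X = on0 R X" if "X \<in> Obj (loose A)" for X
    using ext that by (simp add: fun_eq_def comp_fun_def A.Obj_tight)
  have "\<forall>t \<in> Mor (tight A). on1 K' (on1 (incl A) t) = on1 R t"
    using ext by (simp add: fun_eq_def comp_fun_def)
  then have K'R: "on1 K' t = R1 t" if "is_tight A t" for t
    using A.as_tight_arr(1,2)[OF that] by metis
  have G1: "on1 G (on1 K' f) = on1 S f" if "f \<in> Mor (loose A)" for f
    using lift that by (simp add: fun_eq_def comp_fun_def)
  have G2: "on2 G (on2 K' \<alpha>) = on2 S \<alpha>" if "\<alpha> \<in> Cell (loose A)" for \<alpha>
    using lift that by (simp add: fun_eq_def comp_fun_def)
  have K'1: "on1 K' f = K1 f" if f: "f \<in> Mor (loose A)" for f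
  proof -
    obtain C p l q d \<eta> d' \<eta>' where P: "limit_presentation (loose A) A w f C p l q d \<eta>"
      and L: "lifts p d \<eta> d' \<eta>'" and K: "K1 f = R1 q \<odot>\<^sub>D d'"
      using K1_is_value[OF f] unfolding is_value_def by blast
    interpret P: limit_presentation "loose A" A w f C p l q d \<eta> by (rule P)
    have "w_reflection w D (R1 p) (on1 K' d) (on2 K' \<eta>)"
      using P.refl K'.on_reflection[OF P.refl_L] K'.on2_invertible[of \<eta>]
      by (simp add: A.w_reflection_iff D.w_reflection_iff K'R)
    then have "lifts p d \<eta> (on1 K' d) (on2 K' \<eta>)"
      by (simp add: lifts_def P.refl G1 G2)
    from lifts_unique[OF this L] have "on1 K' (q \<odot>\<^sub>A d) = R1 q \<odot>\<^sub>D d'"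
      by (simp add: K'.on1_comp K'R)
    then show ?thesis by (simp add: P.q_d K)
  qed
  have "on2 K' \<alpha> = K2 \<alpha>" if "\<alpha> \<in> Cell (loose A)" for \<alpha>
    using that by (intro cell_eqI) (simp_all add: K'1 G2)
  then show ?thesis using K'0 K'1 by (simp add: fun_eq_def)
qed

end

lemma F_category_localeI: "F_category A \<Longrightarrow> F_category_locale (loose A) A"
  by (simp add: F_category_locale_def F_category_locale_axioms_def F_category_def two_functor_def)

lemma incl_orthogonal_if_not_Colax:
  assumes w: "w \<noteq> Colax" and A: "F_category A"
    and limits: "\<And>f. f \<in> Mor (loose A) \<Longrightarrow> \<exists>C p l q. cone_limit A (w_cone w A f) f C p l q"
    and G: "doctrinal w D E G"
  shows "orthogonal (all_tight (tight A)) A (incl A) D E G"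
  unfolding orthogonal_def
proof (intro allI impI, elim conjE)
  fix R S
  assume R: "F_functor (all_tight (tight A)) D R" and S: "F_functor A E S"
    and sq: "fun_eq (loose (all_tight (tight A))) (G \<circ>\<^sub>2 R) (S \<circ>\<^sub>2 incl A)"
  have D: "F_category D" and E: "F_category E"
    using G by (simp_all add: doctrinal_def F_functor_def)
  interpret A: F_category_locale "loose A" A by (rule F_category_localeI[OF A])
  interpret D: F_category_locale "loose D" D by (rule F_category_localeI[OF D])
  interpret E: F_category_locale "loose E" E by (rule F_category_localeI[OF E])
  interpret G: two_functor "loose D" "loose E" G
    using G by (simp add: doctrinal_def F_functor_def)
  interpret S: two_functor "loose A" "loose E" S
    using S by (simp add: F_functor_def)
  interpret R: two_functor "tight A" "loose D" R
    using R by (simp add: F_functor_def all_tight_def)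
  have R_tight: "is_tight D (on1 R t)" if "t \<in> Mor (tight A)" for t
    using R that by (auto simp: F_functor_def is_tight_def all_tight_def id_fun_def)
  interpret lifting_problem A D E G R S w
    by unfold_locales
      (use w limits R_tight S G sq in \<open>auto simp: doctrinal_def F_functor_def all_tight_def\<close>)
  show "\<exists>K. F_functor A D K \<and> fun_eq (loose (all_tight (tight A))) (K \<circ>\<^sub>2 incl A) R \<and>
      fun_eq (loose A) (G \<circ>\<^sub>2 K) S \<and>
      (\<forall>K'. F_functor A D K' \<and> fun_eq (loose (all_tight (tight A))) (K' \<circ>\<^sub>2 incl A) R \<and>
        fun_eq (loose A) (G \<circ>\<^sub>2 K') S \<longrightarrow> fun_eq (loose A) K' K)"
    using filler_F_functor filler_extends filler_lifts filler_unique
    by (intro exI[of _ filler]) (simp add: all_tight_def)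
qed

section \<open>Reversal of 2-cells\<close>

lemma co2_simps [simp]:
  "Obj (co2 A) = Obj A" "Mor (co2 A) = Mor A" "src (co2 A) = src A" "trg (co2 A) = trg A"
  "id1 (co2 A) = id1 A" "comp1 (co2 A) = comp1 A" "Cell (co2 A) = Cell A" "dom2 (co2 A) = cod2 A"
  "cod2 (co2 A) = dom2 A" "id2 (co2 A) = id2 A" "vcomp (co2 A) = (\<lambda>\<beta> \<alpha>. \<alpha> \<bullet>\<^bsub>A\<^esub> \<beta>)"
  "hcomp (co2 A) = hcomp A"
  by (simp_all add: co2_def)

lemma co2_co2 [simp]: "co2 (co2 A) = A"
  by (simp add: co2_def)

lemma hom_co2 [simp]: "hom1 (co2 A) X Y = hom1 A X Y" "hom2 (co2 A) f g = hom2 A g f"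
  by (auto simp: hom1_def hom2_def)

lemma co_simps [simp]:
  "tight (co A) = co2 (tight A)" "loose (co A) = co2 (loose A)" "incl (co A) = incl A"
  "is_tight (co A) f = is_tight A f" "co (co A) = A"
  by (simp_all add: co_def is_tight_def)

lemma two_category_co2:
  assumes "two_category A"
  shows "two_category (co2 A)"
proof -
  interpret two_category A by (rule assms)
  show ?thesis
  proof (unfold_locales, unfold hom_co2 co2_simps, goal_cases)
    case 1 then show ?case by simp
  next
    case 2 then show ?case by (rule id1_hom)
  next
    case 3 then show ?case by (rule comp1_hom)
  next
    case 4 then show ?case by (rule comp1_id_left)
  next
    case 5 then show ?case by (rule comp1_id_right)
  next
    case 6 then show ?case by (rule comp1_assoc)
  next
    case 7 then show ?case by simp
  next
    case 8 then show ?case by (rule id2_hom)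
  next
    case 9 then show ?case by (rule vcomp_hom[rotated])
  next
    case 10 then show ?case by (rule vcomp_id_right)
  next
    case 11 then show ?case by (rule vcomp_id_left)
  next
    case (12 \<alpha> f g \<beta> h \<gamma> k)
    then show ?case using vcomp_assoc[of \<gamma> k h \<beta> g \<alpha> f] by simp
  next
    case (13 \<alpha> f f' \<beta> g g')
    then show ?case by (intro hcomp_hom) (auto simp: hom2_def)
  next
    case 14 then show ?case by (rule hcomp_id2)
  next
    case (15 \<alpha> f f' \<alpha>' f'' \<beta> g g' \<beta>' g'')
    then have "trg A f'' = src A g''"
      using cell_arr(3)[of \<beta>] cell_arr(3)[of \<beta>'] cell_arr(4)[of \<alpha>] cell_arr(4)[of \<alpha>']
      by (auto simp: hom2_def simp del: cell_arr)
    then show ?case using 15 by (intro interchange[of \<alpha>' f'' f' \<alpha> f \<beta>' g'' g' \<beta> g]) (auto simp: hom2_def)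
  next
    case (16 \<alpha> f g X Y)
    then show ?case by (intro hcomp_id_left[of \<alpha> g f X Y]) (auto simp: hom1_def hom2_def)
  next
    case (17 \<alpha> f g X Y)
    then show ?case by (intro hcomp_id_right[of \<alpha> g f X Y]) (auto simp: hom1_def hom2_def)
  next
    case (18 \<alpha> f f' \<beta> g g' \<gamma> h h')
    then show ?case by (intro hcomp_ass) (auto simp: hom2_def)
  qed
qed

lemma two_functor_co2:
  assumes "two_functor A B F"
  shows "two_functor (co2 A) (co2 B) F"
proof -
  interpret two_functor A B F by (rule assms)
  interpret cA: two_category "co2 A" by (rule two_category_co2) unfold_locales
  interpret cB: two_category "co2 B" by (rule two_category_co2) unfold_locales
  show ?thesis
  proof (unfold_locales, unfold hom_co2 co2_simps, goal_cases)
    case 1 then show ?case by (rule on0_Obj)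
  next
    case 2 then show ?case by (rule on1_hom)
  next
    case 3 then show ?case by (rule on1_id1)
  next
    case 4 then show ?case by (rule on1_comp1)
  next
    case 5 then show ?case by (rule on2_hom)
  next
    case 6 then show ?case by (rule on2_id2)
  next
    case 7 then show ?case by (intro on2_vcomp)
  next
    case 8 then show ?case by (intro on2_hcomp_arr) (auto simp: hom2_def)
  qed
qed

lemma F_category_co:
  assumes "F_category A"
  shows "F_category (co A)"
  using assms two_functor_co2[of "tight A" "loose A" "incl A"]
  unfolding F_category_def by simp

lemma F_functor_co:
  assumes "F_functor A B F"
  shows "F_functor (co A) (co B) F"
  using assms two_functor_co2[of "loose A" "loose B" F] F_category_co[of A] F_category_co[of B]
  unfolding F_functor_def by simp

lemma F_functor_co_iff: "F_functor (co A) (co B) F \<longleftrightarrow> F_functor A B F"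
  using F_functor_co[of A B F] F_functor_co[of "co A" "co B" F] by auto

lemma orthogonal_co:
  "orthogonal (co X) (co Y) J (co B) (co C) G \<longleftrightarrow> orthogonal X Y J B C G"
  unfolding orthogonal_def F_functor_co_iff by (simp add: fun_eq_def)

lemma doctrinal_co:
  assumes "doctrinal Colax D E G"
  shows "doctrinal Lax (co D) (co E) G"
  using assms by (auto simp: doctrinal_def F_functor_co_iff locally_faithful_def)

lemma all_tight_co2: "all_tight (co2 T) = co (all_tight T)"
  by (simp add: all_tight_def co_def)

lemma w_cone_eq: "w_cone Lax A f = colax_cone A f" "w_cone Pseudo A f = pseudo_cone A f"
  by (simp_all add: fun_eq_iff w_cone_def pseudo_cone_def)

text \<open>Reversing the 2-cells of all the F-categories involved reduces the colax case to the lax one: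
  lax limits become colax limits, c-doctrinal F-functors become l-doctrinal ones, and the notion of
  orthogonality is unchanged.\<close>

lemma incl_orthogonal:
  assumes A: "F_category A" and limits: "has_loose_limits (bar w) A" and G: "doctrinal w D E G"
  shows "orthogonal (all_tight (tight A)) A (incl A) D E G"
proof (cases w)
  case Lax
  have "\<exists>C p l q. cone_limit A (w_cone Lax A f) f C p l q" if "f \<in> Mor (loose A)" for f
    using limits that by (simp add: Lax has_loose_limits_def colax_limit_def w_cone_eq)
  from incl_orthogonal_if_not_Colax[OF _ A this] show ?thesis using G Lax by simp
next
  case Pseudo
  have "\<exists>C p l q. cone_limit A (w_cone Pseudo A f) f C p l q" if "f \<in> Mor (loose A)" for f
    using limits that
    by (simp add: Pseudo has_loose_limits_def pseudo_limit_def w_cone_eq)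
  from incl_orthogonal_if_not_Colax[OF _ A this] show ?thesis using G Pseudo by simp
next
  case Colax
  have "\<exists>C p l q. cone_limit (co A) (w_cone Lax (co A) f) f C p l q" if "f \<in> Mor (loose (co A))" for f
    using limits that
    by (simp add: Colax has_loose_limits_def lax_limit_def colax_limit_def w_cone_eq)
  from incl_orthogonal_if_not_Colax[OF _ F_category_co[OF A] this]
  have "orthogonal (all_tight (tight (co A))) (co A) (incl (co A)) (co D) (co E) G"
    using doctrinal_co[of D E G] G Colax by simp
  then show ?thesis by (simp add: all_tight_co2 orthogonal_co)
qed

section \<open>The decomposition\<close>

lemma two_functor_comp:
  assumes "two_functor A B F" "two_functor B C G"
  shows "two_functor A C (G \<circ>\<^sub>2 F)"
proof -
  interpret F: two_functor A B F by (rule assms)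
  interpret G: two_functor B C G by (rule assms)
  show ?thesis
  proof (unfold_locales, unfold comp_fun_def two_fun.simps o_apply, goal_cases)
    case 1 then show ?case by (intro G.on0_Obj F.on0_Obj)
  next
    case 2 then show ?case by (intro G.on1_hom F.on1_hom)
  next
    case 3 then show ?case by (simp add: F.on1_id1 G.on1_id1 F.on0_Obj)
  next
    case 4 then show ?case by (auto simp: hom1_def F.on1_comp G.on1_comp)
  next
    case 5 then show ?case by (intro G.on2_hom F.on2_hom)
  next
    case 6 then show ?case by (simp add: F.on2_id2 G.on2_id2)
  next
    case 7 then show ?case by (auto simp: hom2_def F.on2_vcomp_arr G.on2_vcomp_arr)
  next
    case 8 then show ?case by (auto simp: hom2_def F.on2_hcomp_arr G.on2_hcomp_arr)
  qed
qed

lemma two_functor_cong: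
  assumes "two_functor A B F" and eq: "fun_eq A F F'"
  shows "two_functor A B F'"
proof -
  interpret two_functor A B F by (rule assms)
  have eqs: "X \<in> Obj A \<Longrightarrow> on0 F' X = on0 F X" "f \<in> Mor A \<Longrightarrow> on1 F' f = on1 F f"
    "\<alpha> \<in> Cell A \<Longrightarrow> on2 F' \<alpha> = on2 F \<alpha>" for X f \<alpha>
    using eq by (simp_all add: fun_eq_def)
  show ?thesis
  proof (unfold_locales, goal_cases)
    case 1 then show ?case by (simp add: eqs on0_Obj)
  next
    case 2 then show ?case by (auto simp: hom1_def eqs)
  next
    case 3 then show ?case by (simp add: eqs on1_id1)
  next
    case 4 then show ?case by (auto simp: hom1_def eqs on1_comp)
  next
    case 5 then show ?case by (auto simp: hom2_def eqs)
  next
    case 6 then show ?case by (simp add: eqs on2_id2)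
  next
    case 7 then show ?case by (auto simp: hom2_def eqs on2_vcomp_arr)
  next
    case 8 then show ?case by (auto simp: hom2_def eqs on2_hcomp_arr)
  qed
qed

lemma all_tight_simps [simp]:
  "tight (all_tight T) = T" "loose (all_tight T) = T" "incl (all_tight T) = id_fun"
  "is_tight (all_tight T) f \<longleftrightarrow> f \<in> Mor T"
  by (auto simp: all_tight_def is_tight_def id_fun_def)

lemma F_category_all_tight:
  assumes "two_category T"
  shows "F_category (all_tight T)"
proof -
  interpret two_category T by (rule assms)
  have "two_functor T T id_fun"
    by unfold_locales (simp_all add: id_fun_def)
  then show ?thesis
    by (simp add: F_category_def) (simp add: id_fun_def bij_betw_def)
qed

lemma inv_into_ident: "y \<in> M \<Longrightarrow> inv_into M (\<lambda>x. x) y = y"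
  using inv_into_f_f[of "\<lambda>x. x" M y] by (simp add: inj_on_def)

text \<open>All inclusions of a 2-category viewed as an F-category are identities, so the inverses chosen in
  the tight part of \<open>H\<close> do nothing.\<close>

lemma tight_part_all_tight:
  assumes "F_functor A (all_tight B) H"
  shows "fun_eq (tight A) (H \<circ>\<^sub>2 incl A) (tight_part A (all_tight B) H)"
proof -
  interpret i: two_functor "tight A" "loose A" "incl A"
    using assms by (simp add: F_functor_def F_category_def)
  interpret H: two_functor "loose A" B H
    using assms by (simp add: F_functor_def)
  have X: "on0 (incl A) X = X" if "X \<in> Obj (tight A)" for X
    using assms that by (simp add: F_functor_def F_category_def)
  show ?thesis
    by (simp add: fun_eq_def comp_fun_def tight_part_def id_fun_def X inv_into_ident)
qed

theorem corollary22:
  fixes w :: laxity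
    and A :: "('o, 'm, 'c, 'n, 'd) F_cat"
    and B :: "('o1, 'm1, 'c1) two_cat"
    and H :: "('o, 'n, 'd, 'o1, 'm1, 'c1) two_fun"
  assumes "F_category A" and "two_category B"
    and "F_functor A (all_tight B) H"
    and "has_loose_limits (bar w) A"
    and "doctrinal w A (all_tight B) H"
  shows "F_functor (all_tight (tight A)) A (incl A) \<and>
    F_functor (all_tight (tight A)) (all_tight B) (tight_part A (all_tight B) H) \<and>
    fun_eq (tight A) (H \<circ>\<^sub>2 incl A) (tight_part A (all_tight B) H) \<and>
    (\<forall>(D :: ('o2, 'm2, 'c2, 'n2, 'd2) F_cat) (E :: ('o3, 'm3, 'c3, 'n3, 'd3) F_cat) G.
       doctrinal w D E G \<longrightarrow> orthogonal (all_tight (tight A)) A (incl A) D E G) \<and>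
    doctrinal w A (all_tight B) H"
proof (intro conjI allI impI)
  interpret i: two_functor "tight A" "loose A" "incl A"
    using assms(1) by (simp add: F_category_def)
  have tA: "F_category (all_tight (tight A))"
    by (rule F_category_all_tight) unfold_locales
  show "F_functor (all_tight (tight A)) A (incl A)"
    using tA assms(1) by (simp add: F_functor_def i.two_functor_axioms) (simp add: is_tight_def)
  show Hj: "fun_eq (tight A) (H \<circ>\<^sub>2 incl A) (tight_part A (all_tight B) H)"
    by (rule tight_part_all_tight[OF assms(3)])
  have "two_functor (loose A) B H"
    using assms(3) by (simp add: F_functor_def)
  then interpret t: two_functor "tight A" B "tight_part A (all_tight B) H"
    using two_functor_cong[OF two_functor_comp[OF i.two_functor_axioms] Hj] by blast
  show "F_functor (all_tight (tight A)) (all_tight B) (tight_part A (all_tight B) H)"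
    using tA F_category_all_tight[OF assms(2)] by (simp add: F_functor_def t.two_functor_axioms)
  show "doctrinal w A (all_tight B) H" by (rule assms(5))
  show "orthogonal (all_tight (tight A)) A (incl A) D E G" if "doctrinal w D E G"
    for D :: "('o2, 'm2, 'c2, 'n2, 'd2) F_cat" and E :: "('o3, 'm3, 'c3, 'n3, 'd3) F_cat" and G
    by (rule incl_orthogonal[OF assms(1,4) that])
qed

end
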